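(* Let $n\ge 2$, $d\ge 1$, $p\ge d+1$ be integers, let $A\in\mathbb{R}^{nd\times nd}$ be symmetric, let $Z\in \mathrm{O}(d)^{\otimes n}$, and let $L=\mathrm{BDG}(AZZ^{\top})-A$. Suppose $LZ=0$, $L\succeq 0$ and $\lambda_{d+1}(L)>0$. If $$\frac{\lambda_{\max}(L)}{\lambda_{d+1}(L)}<\alpha_G(p,d),$$ then every second-order critical point $S$ of $$\min_{S\in \mathrm{St}(p,d)^{\otimes n}} -\langle A,SS^{\top}\rangle$$ is a global minimizer and satisfies $SS^{\top}=ZZ^{\top}$. Here $$\alpha_G(p,d):=\sup_{0\le\tau\le1}\alpha_G(p,d,\tau),\qquad \alpha_G(p,d,\tau):=\sup\{\alpha>1:\ r(\tau)\alpha^{-1}\ge G(1-\alpha^{-1},\tau)\},$$ with $$r(\tau):=2(d-1)\tau^2+p-d,\qquad q(\tau):=(d-2)\tau^2-2(d-1)\tau+d,$$ and, for $x>0$, $$G(x,\tau):=\sup_{0\le u\le w\le v\le 1,\ v>0}\left\{q(\tau)\frac{u}{v}\left(2-\frac{pu}{p-d}\right)+d\tau^2\frac{w}{v}\left(2-\frac{pdw}{pd-1}\right)-\frac1x\cdot\frac{(1-dv)_+u^2}{dv^2}\right\}.$$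
   Context: $\mathrm{O}(d)$ is the group of $d\times d$ real orthogonal matrices and $\mathrm{St}(p,d)=\{X\in\mathbb{R}^{d\times p}: XX^{\top}=I_d\}$. Elements of $\mathrm{O}(d)^{\otimes n}\subset\mathbb{R}^{nd\times d}$ and $\mathrm{St}(p,d)^{\otimes n}\subset\mathbb{R}^{nd\times p}$ are vertical concatenations of $n$ blocks, each in $\mathrm{O}(d)$, respectively $\mathrm{St}(p,d)$; $X_{ij}$ denotes the $(i,j)$ block of size $d\times d$ of $X\in\mathbb{R}^{nd\times nd}$. $\mathrm{BDG}(X)=\mathrm{blkdiag}\big(\tfrac{X_{11}+X_{11}^\top}{2},\dots,\tfrac{X_{nn}+X_{nn}^\top}{2}\big)$. $\langle X,Y\rangle=\mathrm{Tr}(XY^\top)$. $\lambda_k$ is the $k$-th smallest eigenvalue and $\lambda_{\max}$ the largest. $z_+=\max\{z,0\}$. A second-order critical point is a point where the Riemannian gradient vanishes and the Riemannian Hessian is positive semidefinite, $\mathrm{St}(p,d)^{\otimes n}$ being regarded as an embedded submanifold of $\mathbb{R}^{nd\times p}$ with the Frobenius inner product. Convention: $\sup\emptyset=-\infty$. *)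

theory Defs
  imports "HOL-Analysis.Analysis"
begin

section \<open>Symmetric matrices and their spectra\<close>

definition symmetric_matrix :: "real^'a^'a \<Rightarrow> bool" where
  "symmetric_matrix M \<longleftrightarrow> transpose M = M"

definition psd_matrix :: "real^'a^'a \<Rightarrow> bool" where
  "psd_matrix M \<longleftrightarrow> symmetric_matrix M \<and> (\<forall>x. 0 \<le> x \<bullet> (M *v x))"

definition eigenspace :: "real^'a^'a \<Rightarrow> real \<Rightarrow> (real^'a) set" where
  "eigenspace M \<mu> = {x. M *v x = \<mu> *\<^sub>R x}"

definition eigenvalues :: "real^'a^'a \<Rightarrow> real set" where
  "eigenvalues M = {\<mu>. \<exists>x. x \<noteq> 0 \<and> M *v x = \<mu> *\<^sub>R x}"

text \<open>
  The eigenvalues in increasing order, each repeated according to the dimension of its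
  eigenspace. This is used for symmetric matrices only, for which geometric and
  algebraic multiplicities agree and the list has full length.
\<close>
definition sorted_eigenvalues :: "real^'a^'a \<Rightarrow> real list" where
  "sorted_eigenvalues M =
     concat (map (\<lambda>\<mu>. replicate (dim (eigenspace M \<mu>)) \<mu>) (sorted_list_of_set (eigenvalues M)))"

text \<open>The \<open>k\<close>-th smallest eigenvalue; \<open>k\<close> counts from 1, list positions from 0.\<close>
definition nth_eigenvalue :: "nat \<Rightarrow> real^'a^'a \<Rightarrow> real" where
  "nth_eigenvalue k M = sorted_eigenvalues M ! (k - 1)"

definition max_eigenvalue :: "real^'a^'a \<Rightarrow> real" where
  "max_eigenvalue M = Max (eigenvalues M)"

definition frob_inner :: "real^'a^'b \<Rightarrow> real^'a^'b \<Rightarrow> real" where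
  "frob_inner X Y = trace (X ** transpose Y)"


section \<open>Block matrices\<close>

text \<open>
  A row (or column) index of an \<open>nd\<close>-dimensional object is a pair \<open>(i, a)\<close> in \<open>'n \<times> 'd\<close>:
  the \<open>a\<close>-th position inside the \<open>i\<close>-th block. Here \<open>n = CARD('n)\<close>, \<open>d = CARD('d)\<close>,
  \<open>p = CARD('p)\<close>, and \<open>real^'c^'r\<close> has rows indexed by \<open>'r\<close> and columns by \<open>'c\<close>.
\<close>

definition block :: "real^('n::finite \<times> 'd::finite)^('n \<times> 'd) \<Rightarrow> 'n \<Rightarrow> 'n \<Rightarrow> real^'d^'d" where
  "block X i j = (\<chi> a b. X $ (i, a) $ (j, b))"

definition row_block :: "real^'p^('n::finite \<times> 'd::finite) \<Rightarrow> 'n \<Rightarrow> real^'p^'d" where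
  "row_block S i = (\<chi> a. S $ (i, a))"

definition BDG :: "real^('n::finite \<times> 'd::finite)^('n \<times> 'd) \<Rightarrow> real^('n \<times> 'd)^('n \<times> 'd)" where
  "BDG X = (\<chi> r s. if fst r = fst s
     then ((1/2) *\<^sub>R (block X (fst r) (fst r) + transpose (block X (fst r) (fst r)))) $ snd r $ snd s
     else 0)"

definition orthogonal_blocks :: "(real^'d^('n::finite \<times> 'd::finite)) set" where
  "orthogonal_blocks = {Z. \<forall>i. orthogonal_matrix (row_block Z i)}"

definition stiefel :: "(real^'p^'d) set" where
  "stiefel = {X. X ** transpose X = mat 1}"

definition stiefel_blocks :: "(real^'p^('n::finite \<times> 'd::finite)) set" where
  "stiefel_blocks = {S. \<forall>i. row_block S i \<in> stiefel}"

definition objective :: "real^'r^'r \<Rightarrow> real^'p^'r \<Rightarrow> real" where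
  "objective A S = - frob_inner A (S ** transpose S)"


section \<open>Riemannian gradient and Hessian on an embedded submanifold\<close>

text \<open>
  \<open>M\<close> is an embedded submanifold of a Euclidean space, with the metric induced by the
  ambient inner product \<open>\<bullet>\<close>. On \<open>real^'p^'r\<close> this is the sum of the products of the
  entries, that is, the Frobenius inner product.
\<close>

text \<open>
  \<open>c\<close> is, on some open interval around 0, an infinitely differentiable curve lying in \<open>M\<close>
  (\<open>D k\<close> is the \<open>k\<close>-th derivative of \<open>c\<close>).
\<close>
definition smooth_curve_in :: "'a::real_normed_vector set \<Rightarrow> (real \<Rightarrow> 'a) \<Rightarrow> bool" where
  "smooth_curve_in M c \<longleftrightarrow> (\<exists>e>0. (\<forall>t\<in>{-e<..<e}. c t \<in> M) \<and>
     (\<exists>D :: nat \<Rightarrow> real \<Rightarrow> 'a. D 0 = c \<and>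
        (\<forall>k. \<forall>t\<in>{-e<..<e}. (D k has_vector_derivative D (Suc k) t) (at t))))"

definition curve_through :: "'a::real_normed_vector set \<Rightarrow> 'a \<Rightarrow> 'a \<Rightarrow> (real \<Rightarrow> 'a) \<Rightarrow> bool" where
  "curve_through M x v c \<longleftrightarrow>
     smooth_curve_in M c \<and> c 0 = x \<and> (c has_vector_derivative v) (at 0)"

definition tangent_space :: "'a::real_normed_vector set \<Rightarrow> 'a \<Rightarrow> 'a set" where
  "tangent_space M x = {v. \<exists>c. curve_through M x v c}"

text \<open>The tangent vector representing the differential of \<open>f\<close> restricted to \<open>M\<close>.\<close>
definition riemannian_gradient :: "'a::euclidean_space set \<Rightarrow> ('a \<Rightarrow> real) \<Rightarrow> 'a \<Rightarrow> 'a" where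
  "riemannian_gradient M f x =
     (THE g. g \<in> tangent_space M x \<and>
        (\<forall>v c. curve_through M x v c \<longrightarrow>
           ((\<lambda>t. f (c t)) has_real_derivative (g \<bullet> v)) (at 0)))"

text \<open>
  The covariant derivative of the gradient field in the direction \<open>v\<close>. The Levi-Civita
  connection of an embedded submanifold is the ambient derivative followed by the orthogonal
  projection onto the tangent space; \<open>closest_point\<close> is that projection, the tangent space
  being a linear subspace. The ambient derivative is taken along a curve in \<open>M\<close> with
  velocity \<open>v\<close>, so that no extension of the field off \<open>M\<close> is needed.
\<close>
definition riemannian_hessian :: "'a::euclidean_space set \<Rightarrow> ('a \<Rightarrow> real) \<Rightarrow> 'a \<Rightarrow> 'a \<Rightarrow> 'a" where
  "riemannian_hessian M f x v =
     (THE h. \<forall>c. curve_through M x v c \<longrightarrow>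
        (\<exists>D. ((\<lambda>t. riemannian_gradient M f (c t)) has_vector_derivative D) (at 0) \<and>
             h = closest_point (tangent_space M x) D))"

definition second_order_critical :: "'a::euclidean_space set \<Rightarrow> ('a \<Rightarrow> real) \<Rightarrow> 'a \<Rightarrow> bool" where
  "second_order_critical M f x \<longleftrightarrow> x \<in> M \<and> riemannian_gradient M f x = 0 \<and>
     (\<forall>v\<in>tangent_space M x. 0 \<le> v \<bullet> riemannian_hessian M f x v)"


section \<open>The condition-number threshold\<close>

definition r_fun :: "nat \<Rightarrow> nat \<Rightarrow> real \<Rightarrow> real" where
  "r_fun p d \<tau> = 2 * (real d - 1) * \<tau>\<^sup>2 + real p - real d"

definition q_fun :: "nat \<Rightarrow> real \<Rightarrow> real" where
  "q_fun d \<tau> = (real d - 2) * \<tau>\<^sup>2 - 2 * (real d - 1) * \<tau> + real d"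

text \<open>
  Suprema are taken in the extended reals, where the supremum of the empty set is \<open>-\<infinity>\<close>.
\<close>

definition G_fun :: "nat \<Rightarrow> nat \<Rightarrow> real \<Rightarrow> real \<Rightarrow> ereal" where
  "G_fun p d x \<tau> =
     Sup {ereal (q_fun d \<tau> * (u / v) * (2 - real p * u / (real p - real d))
               + real d * \<tau>\<^sup>2 * (w / v) * (2 - real p * real d * w / (real p * real d - 1))
               - (1 / x) * (max (1 - real d * v) 0 * u\<^sup>2 / (real d * v\<^sup>2)))
          | u w v :: real. 0 \<le> u \<and> u \<le> w \<and> w \<le> v \<and> v \<le> 1 \<and> 0 < v}"

definition alpha_G_at :: "nat \<Rightarrow> nat \<Rightarrow> real \<Rightarrow> ereal" where
  "alpha_G_at p d \<tau> =
     Sup {ereal \<alpha> | \<alpha> :: real. 1 < \<alpha> \<and> G_fun p d (1 - inverse \<alpha>) \<tau> \<le> ereal (r_fun p d \<tau> * inverse \<alpha>)}"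

definition alpha_G :: "nat \<Rightarrow> nat \<Rightarrow> ereal" where
  "alpha_G p d = (SUP \<tau>\<in>{0..1}. alpha_G_at p d \<tau>)"

end

theory Submission
  imports Defs
begin

text \<open>
  Write \<open>S\<^sub>i\<close> for the blocks of a second-order critical point \<open>S\<close>, \<open>P\<^sub>i = S\<^sub>i\<^sup>T S\<^sub>i\<close> for the
  projection onto the row space of \<open>S\<^sub>i\<close>, and assume, after replacing \<open>S\<^sub>i\<close> by \<open>Z\<^sub>i\<^sup>T S\<^sub>i\<close> and
  conjugating \<open>L\<close> accordingly, that every \<open>Z\<^sub>i\<close> is the identity. Then \<open>L\<close> annihilates the
  families with equal blocks, and on the families with mean zero it lies between
  \<open>\<lambda> = \<lambda>\<^bsub>d+1\<^esub>(L)\<close> and \<open>\<Lambda> = \<lambda>\<^bsub>max\<^esub>(L)\<close>. The gradient of the objective vanishes at \<open>S\<close> iff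
  \<open>L S = C S\<close> for a certain symmetric block diagonal matrix \<open>C\<close>, and then the Hessian is
  positive semidefinite iff \<open>\<langle>V, C V\<rangle> \<le> \<langle>V, L V\<rangle>\<close> for all tangent \<open>V\<close>
  (\<open>second_order_critical_stiefel\<close>). It suffices to show that \<open>S\<close> has equal blocks
  (\<open>critical_family_constant\<close>): then \<open>S = Z M\<close> with orthonormal rows in \<open>M\<close>, so
  \<open>S S\<^sup>T = Z Z\<^sup>T\<close>, and \<open>L\<close> is a dual certificate of optimality (\<open>objective_eq_certificate\<close>).

  Suppose that the blocks are not all equal. The Hessian inequality is tested on
  \<open>V\<^sub>i = \<Phi> (I - P\<^sub>i) + \<tau> (\<Phi> S\<^sub>i\<^sup>T - S\<^sub>i \<Phi>\<^sup>T) S\<^sub>i\<close> and summed over an orthonormal basis of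
  matrices \<open>\<Phi>\<close>, which has the same effect as the expectation over a Gaussian \<open>\<Phi>\<close>. On the left
  the sum is \<open>r(\<tau>) tr C = r(\<tau>) \<langle>S, L S\<rangle>\<close>, at least \<open>r(\<tau>) \<lambda>\<close> times the squared distance of \<open>S\<close>
  to the families with equal blocks. On the right the part \<open>\<Phi>\<close> of \<open>V\<^sub>i\<close>, which is the same in
  all blocks, disappears; bounding \<open>L\<close> above by \<open>\<Lambda>\<close> leaves an expression in \<open>\<Sum> \<langle>P\<^sub>i, P\<^sub>j\<rangle>\<close> and
  \<open>\<Sum> \<langle>S\<^sub>i, S\<^sub>j\<rangle>\<^sup>2\<close>. These two sums are large when the row spaces, respectively the blocks,
  concentrate near one subspace, respectively near one line (\<open>two_level_norm_bound\<close>).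

  The bound by \<open>\<Lambda>\<close> alone is too weak near the optimum. What it discards is the semidefinite
  form \<open>\<Lambda> \<parallel>PV\<parallel>\<^sup>2 - \<langle>V, L V\<rangle>\<close>, where \<open>P\<close> removes the mean, and the gradient condition bounds
  this form below. By the Cauchy-Schwarz inequality for the form, applied to \<open>V\<close> and \<open>S\<close>, it
  is enough to know its values at the pairs \<open>(V, S)\<close>, where \<open>L S = C S\<close> makes everything
  explicit; the terms containing \<open>C\<close> cancel because \<open>\<Sum> C\<^sub>i S\<^sub>i = 0\<close>. The inequality is used
  for the direction whose \<open>\<Phi>\<close> is the polar factor \<open>K\<close> of the mean \<open>X = H K\<close> of the blocks, and
  the gain is governed by the smallest eigenvalue \<open>\<sigma>\<close> of \<open>H\<close>, for which \<open>\<sigma>\<^sup>2 \<ge> 1 - d v\<close>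
  (\<open>polar_factor_smallest_eigenvalue\<close>).

  The three parameters of the supremum that defines \<open>G\<close> measure how far \<open>S\<close> is from having
  equal blocks: \<open>v = 1 - \<parallel>X\<parallel>\<^sup>2 / d\<close>; \<open>w\<close> is the fraction of the total mass of the \<open>S\<^sub>i\<close>
  orthogonal to the line of \<open>X\<close>; and \<open>u\<close> is the fraction outside the row space of \<open>K\<close>.
  Collecting the estimates gives \<open>r(\<tau>) \<lambda>/\<Lambda> \<le> G(1 - 1/\<alpha>, \<tau>)\<close> for every \<open>\<alpha> > 1\<close> with \<open>\<alpha> > \<Lambda>/\<lambda>\<close>,
  whereas the hypothesis on the condition number provides \<open>\<tau>\<close> and such an \<open>\<alpha>\<close> with
  \<open>G(1 - 1/\<alpha>, \<tau>) \<le> r(\<tau>)/\<alpha> < r(\<tau>) \<lambda>/\<Lambda>\<close> (\<open>threshold_contradiction\<close>).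
\<close>

section \<open>The Frobenius inner product\<close>

lemma inner_matrix_eq_sum: "(X::real^'a^'b) \<bullet> Y = (\<Sum>i\<in>UNIV. \<Sum>j\<in>UNIV. X$i$j * Y$i$j)"
  by (simp add: inner_vec_def)

lemma frob_inner_eq_inner: "frob_inner X Y = X \<bullet> Y"
  by (simp add: frob_inner_def inner_matrix_eq_sum trace_def matrix_matrix_mult_def transpose_def)

lemma inner_mult_right_adjoint:
  "(X ** Y) \<bullet> Z = X \<bullet> (Z ** transpose (Y::real^'b^'c))" for X :: "real^'c^'a"
proof -
  have "(X ** Y) \<bullet> Z = (\<Sum>i\<in>UNIV. \<Sum>j\<in>UNIV. \<Sum>k\<in>UNIV. X$i$k * Y$k$j * Z$i$j)"
    by (simp add: inner_matrix_eq_sum matrix_matrix_mult_def sum_distrib_right)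
  also have "\<dots> = (\<Sum>i\<in>UNIV. \<Sum>k\<in>UNIV. \<Sum>j\<in>UNIV. X$i$k * Y$k$j * Z$i$j)"
    by (intro sum.cong refl sum.swap)
  also have "\<dots> = X \<bullet> (Z ** transpose Y)"
    by (simp add: inner_matrix_eq_sum matrix_matrix_mult_def sum_distrib_left transpose_def mult_ac)
  finally show ?thesis .
qed

lemma inner_transpose_transpose: "transpose (X::real^'a^'b) \<bullet> transpose Y = X \<bullet> Y"
  by (simp add: inner_matrix_eq_sum transpose_def) (rule sum.swap)

lemma inner_mult_left_adjoint:
  "(X ** Y) \<bullet> Z = Y \<bullet> (transpose (X::real^'c^'a) ** Z)" for Y :: "real^'b^'c"
proof -
  have "(X ** Y) \<bullet> Z = (transpose Y ** transpose X) \<bullet> transpose Z"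
    by (metis inner_transpose_transpose matrix_transpose_mul)
  also have "\<dots> = transpose Y \<bullet> transpose (transpose X ** Z)"
    by (simp add: inner_mult_right_adjoint matrix_transpose_mul)
  finally show ?thesis by (simp add: inner_transpose_transpose)
qed

lemma trace_eq_inner_mat: "trace (X::real^'a^'a) = X \<bullet> mat 1"
  by (simp add: inner_matrix_eq_sum trace_def mat_def if_distrib cong: if_cong)

lemma linear_mult_left: "linear (\<lambda>X::real^'b^'c. M ** X)" for M :: "real^'c^'a"
  by (rule linearI) (simp_all add: matrix_add_ldistrib matrix_scalar_ac scalar_matrix_assoc)

lemma matrix_mult_add_left: "(A + B) ** C = A ** C + B ** C" for A :: "real^'c^'a"
  by (vector matrix_matrix_mult_def sum.distrib[symmetric] field_simps)

lemma linear_mult_right: "linear (\<lambda>X::real^'c^'a. X ** M)" for M :: "real^'b^'c"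
  by (rule linearI) (simp_all add: matrix_mult_add_left  scalar_matrix_assoc)

lemma linear_transpose: "linear (transpose :: real^'a^'b \<Rightarrow> real^'b^'a)"
  by (rule linearI) (simp_all add: transpose_def vec_eq_iff)

lemma bounded_bilinear_matrix_mult: "bounded_bilinear (\<lambda>(X::real^'c^'a) (Y::real^'b^'c). X ** Y)"
  unfolding bilinear_conv_bounded_bilinear[symmetric] bilinear_def
  using linear_mult_left linear_mult_right by auto

section \<open>Flows of linear vector fields\<close>

text \<open>
  The exponential series of \<open>t f\<close> applied to \<open>x\<close>. It supplies curves all of whose derivatives
  are explicit, as \<open>smooth_curve_in\<close> demands.
\<close>
definition flow :: "('a::euclidean_space \<Rightarrow> 'a) \<Rightarrow> 'a \<Rightarrow> real \<Rightarrow> 'a" where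
  "flow f x t = (\<Sum>n. (t ^ n / fact n) *\<^sub>R (f ^^ n) x)"

lemma norm_funpow_le:
  fixes f :: "'a::real_normed_vector \<Rightarrow> 'a"
  assumes "\<And>x. norm (f x) \<le> K * norm x" "K \<ge> 0"
  shows "norm ((f ^^ n) x) \<le> K ^ n * norm x"
proof (induction n)
  case (Suc n)
  have "norm ((f ^^ Suc n) x) \<le> K * norm ((f ^^ n) x)" using assms(1) by simp
  also have "\<dots> \<le> K * (K ^ n * norm x)" using Suc assms(2) by (rule mult_left_mono)
  finally show ?case by (simp add: mult_ac)
qed simp

lemma summable_flow:
  assumes "linear (f :: 'a::euclidean_space \<Rightarrow> 'a)"
  shows "summable (\<lambda>n. (t ^ n / fact n) *\<^sub>R (f ^^ n) x)"
proof -
  obtain K where K: "\<And>x. norm (f x) \<le> K * norm x" "K > 0"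
    using linear_conv_bounded_linear assms bounded_linear.pos_bounded by (metis mult.commute)
  show ?thesis
  proof (rule summable_comparison_test)
    show "summable (\<lambda>n. (inverse (fact n) * (\<bar>t\<bar> * K) ^ n) * norm x)"
      using summable_exp by (rule summable_mult2)
    show "\<exists>N. \<forall>n\<ge>N. norm ((t ^ n / fact n) *\<^sub>R (f ^^ n) x) \<le> (inverse (fact n) * (\<bar>t\<bar> * K) ^ n) * norm x"
    proof (intro exI[of _ 0] allI impI)
      fix n
      have "norm ((t ^ n / fact n) *\<^sub>R (f ^^ n) x) \<le> (\<bar>t\<bar> ^ n / fact n) * (K ^ n * norm x)"
        using mult_left_mono[OF norm_funpow_le[of f K n x], of "\<bar>t\<bar> ^ n / fact n"] K
        by (simp add: power_abs)
      then show "norm ((t ^ n / fact n) *\<^sub>R (f ^^ n) x) \<le> (inverse (fact n) * (\<bar>t\<bar> * K) ^ n) * norm x"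
        by (simp add: field_simps power_mult_distrib)
    qed
  qed
qed

lemma flow_0: "flow f x 0 = x"
  unfolding flow_def by (subst suminf_finite[of "{0}"]) auto

lemma flow_commute:
  assumes "linear f" shows "flow f (f x) t = f (flow f x t)"
proof -
  have bl: "bounded_linear f" using assms linear_conv_bounded_linear by blast
  have "f (flow f x t) = (\<Sum>n. f ((t ^ n / fact n) *\<^sub>R (f ^^ n) x))"
    unfolding flow_def using bounded_linear.suminf[OF bl summable_flow[OF assms]] by metis
  also have "\<dots> = flow f (f x) t"
    unfolding flow_def by (simp add: linear_cmul[OF assms] funpow_swap1)
  finally show ?thesis by simp
qed

text \<open>
  Each coordinate is an everywhere convergent real power series in \<open>t\<close>, so term-by-term
  differentiation applies; it shifts the series by one step, which amounts to replacing \<open>x\<close> by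
  \<open>f x\<close>.
\<close>
lemma flow_has_vector_derivative:
  assumes "linear f"
  shows "(flow f x has_vector_derivative f (flow f x t)) (at t)"
proof -
  define c where "c b n = ((f ^^ n) x \<bullet> b) / fact n" for b n
  have inner_flow: "flow f y s \<bullet> b = (\<Sum>n. (((f ^^ n) y \<bullet> b) / fact n) * s ^ n)" for y s b
    unfolding flow_def
    using bounded_linear.suminf[OF bounded_linear_inner_left[of b] summable_flow[OF assms, of s y]]
    by (simp add: mult_ac)
  have sm: "summable (\<lambda>n. c b n * s ^ n)" for b s
    using bounded_linear.summable[OF bounded_linear_inner_left[of b] summable_flow[OF assms, of s x]]
    by (simp add: mult_ac c_def)
  have dc: "diffs (c b) = (\<lambda>n. ((f ^^ n) (f x) \<bullet> b) / fact n)" for b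
    by (rule ext) (simp add: diffs_def c_def funpow_swap1 field_simps del: of_nat_Suc)
  have "((\<lambda>s. flow f x s \<bullet> b) has_field_derivative (flow f (f x) t \<bullet> b)) (at t)" for b
    using termdiffs_strong_converges_everywhere[OF sm, of b t]
    unfolding inner_flow dc by (simp add: c_def)
  then have "((\<lambda>s. flow f x s \<bullet> b) has_field_derivative (f (flow f x t) \<bullet> b)) (at t)" for b
    by (simp add: flow_commute[OF assms])
  then have "((\<lambda>s. \<Sum>b\<in>Basis. (flow f x s \<bullet> b) *\<^sub>R b) has_vector_derivative
      (\<Sum>b\<in>Basis. (f (flow f x t) \<bullet> b) *\<^sub>R b)) (at t)"
    by (auto intro!: derivative_eq_intros)
  then show ?thesis by (simp add: euclidean_representation)
qed

text \<open>
  The \<open>k\<close>-th derivative of the flow of \<open>x\<close> is the flow of \<open>f\<^sup>k x\<close>.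
\<close>
lemma curve_through_flow:
  assumes "linear f" "\<And>t. flow f x t \<in> M"
  shows "curve_through M x (f x) (flow f x)"
proof -
  have "smooth_curve_in M (flow f x)"
    unfolding smooth_curve_in_def
  proof (intro exI[of _ 1] conjI ballI exI[of _ "\<lambda>k. flow f ((f ^^ k) x)"] allI assms(2))
    fix k t
    show "(flow f ((f ^^ k) x) has_vector_derivative flow f ((f ^^ Suc k) x) t) (at t)"
      using flow_has_vector_derivative[OF assms(1)] by (simp add: flow_commute[OF assms(1)])
  qed auto
  then show ?thesis
    using flow_has_vector_derivative[OF assms(1), of x 0] by (simp add: curve_through_def flow_0)
qed

text \<open>
  The derivative of \<open>c c\<^sup>T\<close> is \<open>c (\<Omega> + \<Omega>\<^sup>T) c\<^sup>T = 0\<close>. Hence right multiplication by the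
  exponential of a skew matrix keeps the rows orthonormal.
\<close>
lemma quadratic_conserved_by_skew_flow:
  fixes c :: "real \<Rightarrow> real^'p^'d" and \<Omega> :: "real^'p^'p"
  assumes "\<And>t. (c has_vector_derivative c t ** \<Omega>) (at t)" and "transpose \<Omega> = - \<Omega>"
  shows "c t ** transpose (c t) = c 0 ** transpose (c 0)"
proof -
  have bl: "bounded_linear (transpose :: real^'p^'d \<Rightarrow> real^'d^'p)"
    using linear_transpose linear_conv_bounded_linear by blast
  have "((\<lambda>t. c t ** transpose (c t)) has_vector_derivative 0) (at t)" for t
  proof -
    have "((\<lambda>t. c t ** transpose (c t)) has_vector_derivative
        (c t ** transpose (c t ** \<Omega>) + (c t ** \<Omega>) ** transpose (c t))) (at t)"
      by (intro bounded_bilinear.has_vector_derivative[OF bounded_bilinear_matrix_mult]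
          bounded_linear.has_vector_derivative[OF bl] assms)
    moreover have "c t ** transpose (c t ** \<Omega>) = - ((c t ** \<Omega>) ** transpose (c t))"
      using linear_neg[OF linear_mult_left[of "c t"], of "\<Omega> ** transpose (c t)"]
        linear_neg[OF linear_mult_right[of "transpose (c t)"], of \<Omega>]
      by (simp add: matrix_transpose_mul assms(2) matrix_mul_assoc)
    ultimately show ?thesis by simp
  qed
  then obtain k where "\<And>t. t \<in> UNIV \<Longrightarrow> c t ** transpose (c t) = k"
    using has_vector_derivative_zero_constant[of UNIV "\<lambda>t. c t ** transpose (c t)"] by auto
  then show ?thesis by simp
qed

section \<open>Block structure\<close>

lemma linear_row_block: "linear (\<lambda>S::real^'p^('n::finite \<times> 'd::finite). row_block S i)"
  by (rule linearI) (simp_all add: row_block_def vec_eq_iff)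

lemma row_block_mult: "row_block (U ** M) i = row_block U i ** M"
  by (simp add: row_block_def vec_eq_iff matrix_matrix_mult_def)

lemma row_block_eq_iff: "U = V \<longleftrightarrow> (\<forall>i. row_block U i = row_block V i)"
  by (auto simp add: row_block_def vec_eq_iff)

lemma inner_row_blocks:
  "(U::real^'p^('n::finite \<times> 'd::finite)) \<bullet> V = (\<Sum>i\<in>UNIV. row_block U i \<bullet> row_block V i)"
proof -
  have "U \<bullet> V = (\<Sum>i\<in>UNIV. \<Sum>a\<in>UNIV. U $ (i, a) \<bullet> V $ (i, a))"
    by (simp add: inner_vec_def[of U] sum.cartesian_product)
  also have "\<dots> = (\<Sum>i\<in>UNIV. row_block U i \<bullet> row_block V i)"
    by (simp add: inner_vec_def[of "row_block _ _"] row_block_def inner_vec_def[where 'a="real^'p"])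
  finally show ?thesis .
qed

definition block_diagonal :: "('n \<Rightarrow> real^'d^'d) \<Rightarrow> real^('n::finite \<times> 'd::finite)^('n \<times> 'd)" where
  "block_diagonal C = (\<chi> r s. if fst r = fst s then C (fst r) $ snd r $ snd s else 0)"

definition sym_part :: "real^'d^'d \<Rightarrow> real^'d^'d" where
  "sym_part X = (1/2) *\<^sub>R (X + transpose X)"

lemma transpose_sym_part: "transpose (sym_part X) = sym_part X"
  by (simp add: sym_part_def transpose_def vec_eq_iff)

lemma row_block_block_diagonal_mult: "row_block (block_diagonal C ** U) i = C i ** row_block U i"
proof -
  have "(\<Sum>k\<in>UNIV. (if i = fst k then C i $ a $ snd k else 0) * U $ k $ b) =
        (\<Sum>k\<in>UNIV. C i $ a $ k * U $ (i, k) $ b)" for a b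
  proof -
    have "(\<Sum>k\<in>UNIV. (if i = fst k then C i $ a $ snd k else 0) * U $ k $ b) =
       (\<Sum>j\<in>UNIV. \<Sum>k\<in>UNIV. (if i = j then C i $ a $ k else 0) * U $ (j, k) $ b)"
      by (simp add: sum.cartesian_product case_prod_beta)
    also have "\<dots> = (\<Sum>j\<in>UNIV. if i = j then (\<Sum>k\<in>UNIV. C i $ a $ k * U $ (j, k) $ b) else 0)"
      by (intro sum.cong refl) simp
    finally show ?thesis by simp
  qed
  then show ?thesis
    by (simp add: row_block_def block_diagonal_def vec_eq_iff matrix_matrix_mult_def cong: if_cong)
qed

text \<open>
  The multipliers of the constraints \<open>S\<^sub>i S\<^sub>i\<^sup>T = I\<close> are block diagonal matrices of this kind.
\<close>
lemma BDG_mult_transpose: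
  "BDG (U ** transpose V) = block_diagonal (\<lambda>i. sym_part (row_block U i ** transpose (row_block V i)))"
  by (simp add: BDG_def block_diagonal_def sym_part_def block_def row_block_def vec_eq_iff
      matrix_matrix_mult_def transpose_def)

section \<open>Riemannian geometry of the product of Stiefel manifolds\<close>

text \<open>
  The kernel of the differential of the constraints. That these are all velocities of curves
  in the manifold is proved in \<open>tangent_space_stiefel_blocks\<close>.
\<close>
definition stiefel_tangent ::
    "real^'p^('n::finite \<times> 'd::finite) \<Rightarrow> (real^'p^('n \<times> 'd)) set" where
  "stiefel_tangent S = {V. \<forall>i. row_block V i ** transpose (row_block S i) +
     row_block S i ** transpose (row_block V i) = 0}"

definition blockwise_mult_right ::
    "('n \<Rightarrow> real^'p^'p) \<Rightarrow> real^'p^('n::finite \<times> 'd::finite) \<Rightarrow> real^'p^('n \<times> 'd)" where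
  "blockwise_mult_right \<Omega> S = (\<chi> r. (row_block S (fst r) ** \<Omega> (fst r)) $ snd r)"

lemma row_block_blockwise_mult_right [simp]:
  "row_block (blockwise_mult_right \<Omega> S) i = row_block S i ** \<Omega> i"
  by (simp add: row_block_def blockwise_mult_right_def vec_eq_iff)

lemma linear_blockwise_mult_right: "linear (blockwise_mult_right \<Omega>)"
  by (rule linearI) (simp_all add: row_block_eq_iff linear_add[OF linear_row_block]
    linear_cmul[OF linear_row_block] matrix_mult_add_left scalar_matrix_assoc)

text \<open>
  Tangent vectors are infinitesimal rotations of the row vectors. The part of \<open>\<Omega>\<close> inside the
  row space of \<open>X\<close> is counted twice by \<open>X\<^sup>T V - V\<^sup>T X\<close>, which the third term corrects.
\<close>
lemma skew_generator_of_tangent: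
  fixes X V :: "real^'p^'d"
  assumes "X ** transpose X = mat 1" and "V ** transpose X + X ** transpose V = 0"
  obtains \<Omega> where "transpose \<Omega> = - \<Omega>" and "X ** \<Omega> = V"
proof
  let ?W = "V ** transpose X"
  define \<Omega> where "\<Omega> = transpose X ** V - transpose V ** X - transpose X ** (?W ** X)"
  have W: "X ** transpose V = - ?W" using assms(2) by (simp add: eq_neg_iff_add_eq_0 add.commute)
  have tW: "transpose ?W = - ?W" using W by (simp add: matrix_transpose_mul)
  note ls = linear_diff[OF linear_mult_left] linear_neg[OF linear_mult_left]
    linear_diff[OF linear_mult_right] linear_neg[OF linear_mult_right] linear_diff[OF linear_transpose]
  have "transpose (transpose X ** (?W ** X)) = transpose X ** (transpose ?W ** X)"
    by (simp add: matrix_transpose_mul matrix_mul_assoc)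
  also have "\<dots> = - (transpose X ** (?W ** X))" unfolding tW by (simp add: ls)
  finally have 1: "transpose (transpose X ** (?W ** X)) = - (transpose X ** (?W ** X))" .
  show "transpose \<Omega> = - \<Omega>"
    unfolding \<Omega>_def ls 1 by (simp add: matrix_transpose_mul)
  have "X ** \<Omega> = (X ** transpose X) ** V - (X ** transpose V) ** X - (X ** transpose X) ** (?W ** X)"
    unfolding \<Omega>_def ls by (simp add: matrix_mul_assoc)
  then show "X ** \<Omega> = V" unfolding W assms(1) by (simp add: ls)
qed

lemma curve_velocity_in_stiefel_tangent:
  fixes S :: "real^'p^('n::finite \<times> 'd::finite)"
  assumes "curve_through stiefel_blocks S V c"
  shows "V \<in> stiefel_tangent S"
proof -
  obtain e where e: "e > 0" "\<And>t. t \<in> {-e<..<e} \<Longrightarrow> c t \<in> stiefel_blocks" "c 0 = S"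
    and der: "(c has_vector_derivative V) (at 0)"
    using assms unfolding curve_through_def smooth_curve_in_def by blast
  have bl: "bounded_linear (\<lambda>S::real^'p^('n \<times> 'd). row_block S i)"
       "bounded_linear (transpose :: real^'p^'d \<Rightarrow> real^'d^'p)" for i
    using linear_row_block linear_transpose linear_conv_bounded_linear by blast+
  have "row_block V i ** transpose (row_block S i) + row_block S i ** transpose (row_block V i) = 0" for i
  proof -
    let ?h = "\<lambda>t. row_block (c t) i ** transpose (row_block (c t) i)"
    have 1: "(?h has_vector_derivative
        (row_block (c 0) i ** transpose (row_block V i) + row_block V i ** transpose (row_block (c 0) i))) (at 0)"
      by (intro bounded_bilinear.has_vector_derivative[OF bounded_bilinear_matrix_mult]
          bounded_linear.has_vector_derivative[OF bl(2)] bounded_linear.has_vector_derivative[OF bl(1)] der)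
    have 2: "(?h has_vector_derivative 0) (at 0)"
    proof (rule has_vector_derivative_transform_within_open)
      show "((\<lambda>t. mat 1) has_vector_derivative 0) (at 0)" by simp
      show "open {-e<..<e}" "0 \<in> {-e<..<e}" using e by auto
      show "\<And>t. t \<in> {-e<..<e} \<Longrightarrow> mat 1 = ?h t"
        using e(2) by (auto simp: stiefel_blocks_def stiefel_def)
    qed
    show ?thesis using vector_derivative_unique_at[OF 1 2] e(3) by (simp add: add.commute)
  qed
  then show ?thesis by (simp add: stiefel_tangent_def)
qed

text \<open>
  A tangent vector is realised by rotating each block with the exponential of its skew
  generator.
\<close>
lemma tangent_space_stiefel_blocks:
  fixes S :: "real^'p^('n::finite \<times> 'd::finite)"
  assumes "S \<in> stiefel_blocks"
  shows "tangent_space stiefel_blocks S = stiefel_tangent S"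
proof
  show "tangent_space stiefel_blocks S \<subseteq> stiefel_tangent S"
    using curve_velocity_in_stiefel_tangent by (auto simp: tangent_space_def)
  show "stiefel_tangent S \<subseteq> tangent_space stiefel_blocks S"
  proof
    fix V assume V: "V \<in> stiefel_tangent S"
    have "\<exists>\<Omega>. transpose \<Omega> = - \<Omega> \<and> row_block S i ** \<Omega> = row_block V i" for i
    proof -
      have "row_block S i ** transpose (row_block S i) = mat 1"
        "row_block V i ** transpose (row_block S i) + row_block S i ** transpose (row_block V i) = 0"
        using V assms by (auto simp: stiefel_tangent_def stiefel_blocks_def stiefel_def)
      then show ?thesis by (rule skew_generator_of_tangent) blast
    qed
    then obtain \<Omega> where \<Omega>: "\<And>i. transpose (\<Omega> i) = - \<Omega> i" "\<And>i. row_block S i ** \<Omega> i = row_block V i"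
      by metis
    let ?f = "blockwise_mult_right \<Omega> :: real^'p^('n \<times> 'd) \<Rightarrow> _"
    have "row_block (flow ?f S t) i ** transpose (row_block (flow ?f S t) i) = mat 1" for t i
    proof -
      have bl: "bounded_linear (\<lambda>S::real^'p^('n \<times> 'd). row_block S i)"
        using linear_row_block linear_conv_bounded_linear by blast
      have "((\<lambda>t. row_block (flow ?f S t) i) has_vector_derivative row_block (flow ?f S t) i ** \<Omega> i) (at t)" for t
        using bounded_linear.has_vector_derivative[OF bl
            flow_has_vector_derivative[OF linear_blockwise_mult_right[of \<Omega>], of S t]] by simp
      from quadratic_conserved_by_skew_flow[OF this \<Omega>(1)] show ?thesis
        using assms by (simp add: flow_0 stiefel_blocks_def stiefel_def)
    qed
    then have "curve_through stiefel_blocks S (?f S) (flow ?f S)"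
      by (intro curve_through_flow linear_blockwise_mult_right) (auto simp: stiefel_blocks_def stiefel_def)
    moreover have "?f S = V" by (simp add: row_block_eq_iff \<Omega>)
    ultimately show "V \<in> tangent_space stiefel_blocks S" by (auto simp: tangent_space_def)
  qed
qed

lemma subspace_stiefel_tangent: "subspace (stiefel_tangent S)"
proof -
  define h where "h i V = row_block V i ** transpose (row_block S i) +
     row_block S i ** transpose (row_block V i)" for i V
  have "linear (h i)" for i
    unfolding h_def
    using linear_compose[OF linear_row_block[of i] linear_mult_right]
      linear_compose[OF linear_compose[OF linear_row_block[of i] linear_transpose] linear_mult_left]
    by (intro linear_compose_add) (simp_all add: o_def)
  then have "subspace {V. \<forall>i. h i V = 0}"
    by (simp add: subspace_def linear_0 linear_add linear_cmul)
  then show ?thesis by (simp add: h_def stiefel_tangent_def)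
qed

text \<open>
  The Euclidean gradient \<open>-2 A S\<close> minus its component normal to the manifold.
\<close>
definition stiefel_gradient ::
    "real^('n::finite \<times> 'd::finite)^('n \<times> 'd) \<Rightarrow> real^'p^('n \<times> 'd) \<Rightarrow> real^'p^('n \<times> 'd)" where
  "stiefel_gradient A S = (- 2) *\<^sub>R (A ** S - BDG (A ** S ** transpose S) ** S)"

lemma inner_sym_skew:
  fixes C W :: "real^'d^'d"
  assumes "transpose C = C" "W + transpose W = 0"
  shows "C \<bullet> W = 0"
proof -
  have "C \<bullet> W = C \<bullet> transpose W" using inner_transpose_transpose[of C W] assms(1) by simp
  then have "2 * (C \<bullet> W) = C \<bullet> (W + transpose W)" by (simp add: inner_add_right)
  then show ?thesis using assms(2) by simp
qed

text \<open>
  The blocks \<open>V\<^sub>i S\<^sub>i\<^sup>T\<close> of a tangent \<open>V\<close> are skew, hence orthogonal to symmetric matrices.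
  The multiplier terms are therefore normal to the manifold.
\<close>
lemma block_diagonal_normal:
  assumes "\<And>i. transpose (C i) = C i" "V \<in> stiefel_tangent S"
  shows "(block_diagonal C ** S) \<bullet> V = 0"
proof -
  have "(C i ** row_block S i) \<bullet> row_block V i = 0" for i
  proof -
    have "(C i ** row_block S i) \<bullet> row_block V i = C i \<bullet> (row_block V i ** transpose (row_block S i))"
      by (rule inner_mult_right_adjoint)
    also have "\<dots> = 0" using assms
      by (intro inner_sym_skew) (auto simp: stiefel_tangent_def matrix_transpose_mul)
    finally show ?thesis .
  qed
  then show ?thesis by (simp add: inner_row_blocks row_block_block_diagonal_mult)
qed

lemma stiefel_gradient_tangent:
  assumes "S \<in> stiefel_blocks"
  shows "stiefel_gradient A S \<in> stiefel_tangent S"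
proof -
  have "A ** S - BDG (A ** S ** transpose S) ** S \<in> stiefel_tangent S"
    unfolding stiefel_tangent_def mem_Collect_eq
  proof
    fix i
    let ?S = "row_block S i" and ?Y = "row_block (A ** S) i"
    have SS: "?S ** transpose ?S = mat 1" using assms by (simp add: stiefel_blocks_def stiefel_def)
    have r: "row_block (A ** S - BDG (A ** S ** transpose S) ** S) i = ?Y - sym_part (?Y ** transpose ?S) ** ?S"
      by (simp add: linear_diff[OF linear_row_block] BDG_mult_transpose row_block_block_diagonal_mult)
    have "sym_part (?Y ** transpose ?S) ** ?S ** transpose ?S = sym_part (?Y ** transpose ?S)"
      by (simp add: matrix_mul_assoc[symmetric] SS)
    moreover have "?S ** transpose (sym_part (?Y ** transpose ?S) ** ?S) = sym_part (?Y ** transpose ?S)"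
      by (simp add: matrix_transpose_mul matrix_mul_assoc SS transpose_sym_part)
    moreover have "2 *\<^sub>R sym_part (?Y ** transpose ?S) = ?Y ** transpose ?S + ?S ** transpose ?Y"
      by (simp add: sym_part_def matrix_transpose_mul)
    ultimately show "row_block (A ** S - BDG (A ** S ** transpose S) ** S) i ** transpose ?S +
       ?S ** transpose (row_block (A ** S - BDG (A ** S ** transpose S) ** S) i) = 0"
      unfolding r linear_diff[OF linear_transpose] linear_diff[OF linear_mult_left]
        linear_diff[OF linear_mult_right] by (simp add: scaleR_2 algebra_simps)
  qed
  then show ?thesis unfolding stiefel_gradient_def by (rule subspace_scale[OF subspace_stiefel_tangent])
qed

lemma objective_eq_inner: "objective A S = - (S \<bullet> (A ** S))"
  unfolding objective_def frob_inner_eq_inner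
  by (metis inner_commute inner_mult_right_adjoint transpose_transpose)

lemma objective_derivative_along_curve:
  fixes S :: "real^'p^('n::finite \<times> 'd::finite)"
  assumes "symmetric_matrix A" "curve_through stiefel_blocks S V c"
  shows "((\<lambda>t. objective A (c t)) has_real_derivative (stiefel_gradient A S \<bullet> V)) (at 0)"
proof -
  have c: "c 0 = S" "(c has_vector_derivative V) (at 0)" using assms(2) by (auto simp: curve_through_def)
  have bl: "bounded_linear (\<lambda>S::real^'p^('n \<times> 'd). A ** S)"
    using linear_mult_left linear_conv_bounded_linear by blast
  have "((\<lambda>t. objective A (c t)) has_vector_derivative - (c 0 \<bullet> (A ** V) + V \<bullet> (A ** c 0))) (at 0)"
    unfolding objective_eq_inner
    by (intro has_vector_derivative_minus bounded_bilinear.has_vector_derivative[OF bounded_bilinear_inner]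
        bounded_linear.has_vector_derivative[OF bl] c)
  moreover have "S \<bullet> (A ** V) = (A ** S) \<bullet> V"
    using assms(1) by (simp add: inner_mult_left_adjoint symmetric_matrix_def)
  moreover have "(BDG (A ** S ** transpose S) ** S) \<bullet> V = 0"
    unfolding BDG_mult_transpose
    using curve_velocity_in_stiefel_tangent[OF assms(2)] transpose_sym_part
    by (intro block_diagonal_normal) auto
  ultimately show ?thesis
    by (simp add: stiefel_gradient_def c inner_diff_left has_real_derivative_iff_has_vector_derivative
      inner_commute[of V])
qed

text \<open>
  Two tangent vectors that represent the same differential agree: their difference is itself
  the velocity of a curve, so it is orthogonal to itself.
\<close>
lemma riemannian_gradient_stiefel:
  fixes S :: "real^'p^('n::finite \<times> 'd::finite)"
  assumes "symmetric_matrix A" "S \<in> stiefel_blocks"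
  shows "riemannian_gradient stiefel_blocks (objective A) S = stiefel_gradient A S"
  unfolding riemannian_gradient_def
proof (rule the_equality)
  show "stiefel_gradient A S \<in> tangent_space stiefel_blocks S \<and>
     (\<forall>V c. curve_through stiefel_blocks S V c \<longrightarrow>
        ((\<lambda>t. objective A (c t)) has_real_derivative stiefel_gradient A S \<bullet> V) (at 0))"
    using stiefel_gradient_tangent assms objective_derivative_along_curve
    by (auto simp: tangent_space_stiefel_blocks)
  fix g
  assume g: "g \<in> tangent_space stiefel_blocks S \<and>
     (\<forall>V c. curve_through stiefel_blocks S V c \<longrightarrow>
        ((\<lambda>t. objective A (c t)) has_real_derivative g \<bullet> V) (at 0))"
  let ?h = "stiefel_gradient A S"
  have "g - ?h \<in> tangent_space stiefel_blocks S"
    using g stiefel_gradient_tangent[OF assms(2)] subspace_diff[OF subspace_stiefel_tangent]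
    by (auto simp: tangent_space_stiefel_blocks[OF assms(2)])
  then obtain c where c: "curve_through stiefel_blocks S (g - ?h) c" by (auto simp: tangent_space_def)
  have "g \<bullet> (g - ?h) = ?h \<bullet> (g - ?h)"
    using g c objective_derivative_along_curve[OF assms(1) c] DERIV_unique by blast
  then have "(g - ?h) \<bullet> (g - ?h) = 0" by (simp add: inner_diff_left)
  then show "g = ?h" by simp
qed

lemma inner_closest_point_subspace:
  fixes T :: "'a::euclidean_space set"
  assumes "subspace T" "v \<in> T"
  shows "v \<bullet> closest_point T D = v \<bullet> D"
proof -
  let ?q = "closest_point T D"
  have q: "?q \<in> T"
    using closest_point_in_set[OF closed_subspace[OF assms(1)]] assms by auto
  have "(D - ?q) \<bullet> (x - ?q) \<le> 0" if "x \<in> T" for x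
    using closest_point_dot[OF subspace_imp_convex closed_subspace that] assms by auto
  from this[of "?q + v"] this[of "?q - v"] have "v \<bullet> (D - ?q) = 0"
    using q assms by (auto simp: subspace_add subspace_diff inner_diff_left inner_commute)
  then show ?thesis by (simp add: inner_diff_right)
qed

text \<open>
  The derivative of the gradient field at \<open>S\<close> in the direction \<open>V\<close>; only \<open>S\<close> and \<open>V\<close> enter,
  not the curve, which makes the Hessian well defined.
\<close>
definition stiefel_gradient_derivative ::
    "real^('n::finite \<times> 'd::finite)^('n \<times> 'd) \<Rightarrow> real^'p^('n \<times> 'd) \<Rightarrow> real^'p^('n \<times> 'd) \<Rightarrow> real^'p^('n \<times> 'd)" where
  "stiefel_gradient_derivative A S V = (- 2) *\<^sub>R (A ** V - (BDG (A ** S ** transpose S) ** V +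
     BDG (A ** S ** transpose V + A ** V ** transpose S) ** S))"

lemma linear_BDG: "linear (BDG :: real^('n::finite \<times> 'd::finite)^('n \<times> 'd) \<Rightarrow> _)"
  by (rule linearI) (simp_all add: BDG_def block_def transpose_def vec_eq_iff algebra_simps)

lemma stiefel_gradient_derivative_along_curve:
  fixes S :: "real^'p^('n::finite \<times> 'd::finite)"
  assumes "symmetric_matrix A" "curve_through stiefel_blocks S V c"
  shows "((\<lambda>t. riemannian_gradient stiefel_blocks (objective A) (c t)) has_vector_derivative
    stiefel_gradient_derivative A S V) (at 0)"
proof -
  have c: "c 0 = S" "(c has_vector_derivative V) (at 0)" using assms(2) by (auto simp: curve_through_def)
  obtain e where e: "e > 0" "\<And>t. t \<in> {-e<..<e} \<Longrightarrow> c t \<in> stiefel_blocks"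
    using assms(2) unfolding curve_through_def smooth_curve_in_def by blast
  note bl = linear_mult_left[of A, THEN linear_conv_bounded_linear[THEN iffD1]]
    linear_transpose[THEN linear_conv_bounded_linear[THEN iffD1]]
    linear_BDG[THEN linear_conv_bounded_linear[THEN iffD1]]
  have "((\<lambda>t. stiefel_gradient A (c t)) has_vector_derivative stiefel_gradient_derivative A (c 0) V) (at 0)"
    unfolding stiefel_gradient_def stiefel_gradient_derivative_def
    by (intro bounded_linear.has_vector_derivative[OF bounded_linear_scaleR_right]
        has_vector_derivative_diff bounded_bilinear.has_vector_derivative[OF bounded_bilinear_matrix_mult]
        bounded_linear.has_vector_derivative[OF bl(1)] bounded_linear.has_vector_derivative[OF bl(2)]
        bounded_linear.has_vector_derivative[OF bl(3)] c)
  then show ?thesis unfolding c(1)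
  proof (rule has_vector_derivative_transform_within_open)
    show "open {-e<..<e}" "0 \<in> {-e<..<e}" using e by auto
    show "\<And>t. t \<in> {-e<..<e} \<Longrightarrow> stiefel_gradient A (c t) = riemannian_gradient stiefel_blocks (objective A) (c t)"
      using e(2) by (simp add: riemannian_gradient_stiefel[OF assms(1)])
  qed
qed

text \<open>
  Differentiating the multiplier produces a matrix that is normal to the manifold, so it does
  not contribute to the quadratic form of the Hessian.
\<close>
lemma inner_stiefel_gradient_derivative:
  assumes VT: "V \<in> stiefel_tangent S"
  shows "V \<bullet> stiefel_gradient_derivative A S V =
    2 * (V \<bullet> (BDG (A ** S ** transpose S) ** V) - V \<bullet> (A ** V))"
proof -
  have "(BDG (A ** S ** transpose V + A ** V ** transpose S) ** S) \<bullet> V =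
     (BDG (A ** S ** transpose V) ** S) \<bullet> V + (BDG (A ** V ** transpose S) ** S) \<bullet> V"
    unfolding linear_add[OF linear_BDG] by (simp add: matrix_mult_add_left inner_add_left)
  also have "\<dots> = 0"
    unfolding BDG_mult_transpose by (simp add: block_diagonal_normal[OF _ VT] transpose_sym_part)
  finally show ?thesis
    unfolding stiefel_gradient_derivative_def
    by (simp add: inner_diff_right inner_add_right inner_commute[of V] algebra_simps)
qed

lemma riemannian_hessian_stiefel:
  fixes S :: "real^'p^('n::finite \<times> 'd::finite)"
  assumes "symmetric_matrix A" "curve_through stiefel_blocks S V c"
  shows "riemannian_hessian stiefel_blocks (objective A) S V =
    closest_point (tangent_space stiefel_blocks S) (stiefel_gradient_derivative A S V)"
  unfolding riemannian_hessian_def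
proof (rule the_equality)
  note der = stiefel_gradient_derivative_along_curve[OF assms(1)]
  show "\<forall>c. curve_through stiefel_blocks S V c \<longrightarrow>
     (\<exists>D. ((\<lambda>t. riemannian_gradient stiefel_blocks (objective A) (c t)) has_vector_derivative D) (at 0) \<and>
        closest_point (tangent_space stiefel_blocks S) (stiefel_gradient_derivative A S V) =
        closest_point (tangent_space stiefel_blocks S) D)"
    using der by blast
  fix h
  assume "\<forall>c. curve_through stiefel_blocks S V c \<longrightarrow>
     (\<exists>D. ((\<lambda>t. riemannian_gradient stiefel_blocks (objective A) (c t)) has_vector_derivative D) (at 0) \<and>
        h = closest_point (tangent_space stiefel_blocks S) D)"
  then show "h = closest_point (tangent_space stiefel_blocks S) (stiefel_gradient_derivative A S V)"
    using assms(2) der[OF assms(2)] vector_derivative_unique_at by blast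
qed

lemma second_order_critical_stiefel:
  fixes S :: "real^'p^('n::finite \<times> 'd::finite)"
  assumes "symmetric_matrix A" "second_order_critical stiefel_blocks (objective A) S"
  shows "S \<in> stiefel_blocks" and "A ** S = BDG (A ** S ** transpose S) ** S"
    and "\<And>V. V \<in> stiefel_tangent S \<Longrightarrow> V \<bullet> (A ** V) \<le> V \<bullet> (BDG (A ** S ** transpose S) ** V)"
proof -
  show S: "S \<in> stiefel_blocks" using assms(2) by (simp add: second_order_critical_def)
  show "A ** S = BDG (A ** S ** transpose S) ** S"
    using assms riemannian_gradient_stiefel[OF assms(1) S]
    by (simp add: second_order_critical_def stiefel_gradient_def)
  fix V assume V: "V \<in> stiefel_tangent S"
  then obtain c where c: "curve_through stiefel_blocks S V c"
    using tangent_space_stiefel_blocks[OF S] by (auto simp: tangent_space_def)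
  have "0 \<le> V \<bullet> riemannian_hessian stiefel_blocks (objective A) S V"
    using assms(2) V by (simp add: second_order_critical_def tangent_space_stiefel_blocks[OF S])
  also have "\<dots> = V \<bullet> stiefel_gradient_derivative A S V"
    unfolding riemannian_hessian_stiefel[OF assms(1) c] tangent_space_stiefel_blocks[OF S]
    by (rule inner_closest_point_subspace[OF subspace_stiefel_tangent V])
  finally show "V \<bullet> (A ** V) \<le> V \<bullet> (BDG (A ** S ** transpose S) ** V)"
    by (simp add: inner_stiefel_gradient_derivative[OF V])
qed

section \<open>Extremal eigenvalues\<close>

text \<open>
  The discriminant of the nonnegative quadratic \<open>t \<mapsto> \<langle>x + t y, F (x + t y)\<rangle>\<close>.
\<close>
lemma Cauchy_Schwarz_semidefinite:
  fixes F :: "'a::real_inner \<Rightarrow> 'a"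
  assumes "linear F" "subspace U"
    and sym: "\<And>x y. x \<in> U \<Longrightarrow> y \<in> U \<Longrightarrow> x \<bullet> F y = y \<bullet> F x"
    and nonneg: "\<And>x. x \<in> U \<Longrightarrow> 0 \<le> x \<bullet> F x"
    and "x \<in> U" "y \<in> U"
  shows "(x \<bullet> F y)\<^sup>2 \<le> (x \<bullet> F x) * (y \<bullet> F y)"
proof -
  have q: "0 \<le> x \<bullet> F x + 2 * t * (x \<bullet> F y) + t\<^sup>2 * (y \<bullet> F y)" for t
  proof -
    have "x + t *\<^sub>R y \<in> U" using assms by (simp add: subspace_add subspace_scale)
    from nonneg[OF this] show ?thesis
      using sym[of x y] assms(5,6)
      by (simp add: linear_add[OF assms(1)] linear_cmul[OF assms(1)] inner_add_left inner_add_right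
          power2_eq_square algebra_simps)
  qed
  show ?thesis
  proof (cases "y \<bullet> F y = 0")
    case True
    have "x \<bullet> F y = 0"
    proof (rule ccontr)
      assume n: "x \<bullet> F y \<noteq> 0"
      have "0 \<le> x \<bullet> F x + 2 * (- ((x \<bullet> F x + 1) / (2 * (x \<bullet> F y)))) * (x \<bullet> F y)"
        using q[of "- ((x \<bullet> F x + 1) / (2 * (x \<bullet> F y)))"] True by simp
      then show False using n by simp
    qed
    then show ?thesis using True by simp
  next
    case False
    then have pos: "y \<bullet> F y > 0" using nonneg[OF assms(6)] by simp
    have "0 \<le> x \<bullet> F x - (x \<bullet> F y)\<^sup>2 / (y \<bullet> F y)"
      using q[of "- (x \<bullet> F y) / (y \<bullet> F y)"] pos by (simp add: power2_eq_square field_simps)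
    then show ?thesis using pos by (simp add: field_simps)
  qed
qed

text \<open>
  A minimiser \<open>x\<close> of the Rayleigh quotient on the unit sphere of the invariant subspace. The
  form \<open>F - \<mu>\<close> is semidefinite and vanishes at \<open>x\<close>, so by Cauchy-Schwarz \<open>F x - \<mu> x\<close> is
  orthogonal to everything in the subspace, in particular to itself.
\<close>
lemma minimal_eigenvector:
  fixes F :: "'a::euclidean_space \<Rightarrow> 'a"
  assumes F: "linear F" and U: "subspace U" "U \<noteq> {0}" and inv: "\<And>x. x \<in> U \<Longrightarrow> F x \<in> U"
    and sym: "\<And>x y. x \<in> U \<Longrightarrow> y \<in> U \<Longrightarrow> x \<bullet> F y = y \<bullet> F x"
  obtains x \<mu> where "x \<in> U" "norm x = 1" "F x = \<mu> *\<^sub>R x" "\<And>y. y \<in> U \<Longrightarrow> \<mu> * (norm y)\<^sup>2 \<le> y \<bullet> F y"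
proof -
  let ?K = "sphere 0 1 \<inter> U"
  obtain y0 where y0: "y0 \<in> U" "y0 \<noteq> 0" using U subspace_0 by blast
  then have "y0 /\<^sub>R norm y0 \<in> ?K" using U by (simp add: subspace_scale)
  then have ne: "?K \<noteq> {}" by blast
  have "compact ?K" using closed_subspace[OF U(1)] by (intro compact_Int_closed compact_sphere)
  moreover have "continuous_on ?K (\<lambda>x. x \<bullet> F x)"
    by (intro continuous_intros linear_continuous_on F[THEN linear_conv_bounded_linear[THEN iffD1]])
  ultimately obtain x where x: "x \<in> ?K" and min: "\<And>y. y \<in> ?K \<Longrightarrow> x \<bullet> F x \<le> y \<bullet> F y"
    using continuous_attains_inf[OF _ ne] by blast
  define \<mu> where "\<mu> = x \<bullet> F x"
  have xU: "x \<in> U" "norm x = 1" using x by auto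
  have low: "\<mu> * (norm y)\<^sup>2 \<le> y \<bullet> F y" if "y \<in> U" for y
  proof (cases "y = 0")
    case False
    then have "y /\<^sub>R norm y \<in> ?K" using that U by (simp add: subspace_scale)
    from min[OF this] have "\<mu> \<le> (y \<bullet> F y) / (norm y)\<^sup>2"
      by (simp add: \<mu>_def linear_cmul[OF F] power2_eq_square field_simps)
    then show ?thesis using False by (simp add: field_simps)
  qed (simp add: linear_0[OF F])
  let ?G = "\<lambda>y. F y - \<mu> *\<^sub>R y"
  have G: "linear ?G"
    by (rule linearI) (simp_all add: linear_add[OF F] linear_cmul[OF F] algebra_simps)
  have GxU: "?G x \<in> U" using xU U inv by (simp add: subspace_diff subspace_scale)
  have "x \<bullet> ?G x = 0" using xU(2) by (simp add: \<mu>_def inner_diff_right dot_square_norm)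
  moreover have "(?G x \<bullet> ?G x)\<^sup>2 \<le> (?G x \<bullet> ?G (?G x)) * (x \<bullet> ?G x)"
  proof (rule Cauchy_Schwarz_semidefinite[OF G U(1) _ _ GxU xU(1)])
    show "\<And>x y. x \<in> U \<Longrightarrow> y \<in> U \<Longrightarrow> x \<bullet> ?G y = y \<bullet> ?G x"
      using sym by (simp add: inner_diff_right inner_commute)
    show "\<And>x. x \<in> U \<Longrightarrow> 0 \<le> x \<bullet> ?G x"
      using low by (simp add: inner_diff_right dot_square_norm)
  qed
  ultimately have "?G x = 0" by simp
  then show ?thesis using that[of x \<mu>] xU low by simp
qed

lemma symmetric_matrix_inner: "symmetric_matrix M \<Longrightarrow> x \<bullet> (M *v y) = y \<bullet> (M *v x)"
  by (metis dot_lmul_matrix inner_commute symmetric_matrix_def vector_transpose_matrix)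

text \<open>
  Eigenvectors of a symmetric matrix for distinct eigenvalues are orthogonal, hence
  independent.
\<close>
lemma finite_eigenvalues:
  assumes "symmetric_matrix (M :: real^'a^'a)"
  shows "finite (eigenvalues M)"
proof -
  have "\<forall>\<mu>\<in>eigenvalues M. \<exists>x. x \<noteq> 0 \<and> M *v x = \<mu> *\<^sub>R x"
    by (simp add: eigenvalues_def)
  from bchoice[OF this] obtain e
    where "\<forall>\<mu>\<in>eigenvalues M. e \<mu> \<noteq> 0 \<and> M *v e \<mu> = \<mu> *\<^sub>R e \<mu>" ..
  then have e: "e \<mu> \<noteq> 0" "M *v e \<mu> = \<mu> *\<^sub>R e \<mu>" if "\<mu> \<in> eigenvalues M" for \<mu>
    using that by auto
  have orth: "e \<mu> \<bullet> e \<nu> = 0" if "\<mu> \<in> eigenvalues M" "\<nu> \<in> eigenvalues M" "\<mu> \<noteq> \<nu>" for \<mu> \<nu>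
    using symmetric_matrix_inner[OF assms, of "e \<mu>" "e \<nu>"] e[OF that(1)] e[OF that(2)] that(3)
    by (simp add: inner_commute)
  have inj: "inj_on e (eigenvalues M)"
    using orth e by (intro inj_onI) (metis inner_eq_zero_iff)
  have "pairwise orthogonal (e ` eigenvalues M)"
    using orth by (auto simp: pairwise_def orthogonal_def)
  then have "independent (e ` eigenvalues M)"
    using e by (intro pairwise_orthogonal_independent) auto
  then show ?thesis using inj finite_imageD independent_imp_finite by blast
qed

lemma Rayleigh_le_max_eigenvalue:
  assumes "symmetric_matrix (M :: real^'a^'a)"
  shows "x \<bullet> (M *v x) \<le> max_eigenvalue M * (norm x)\<^sup>2"
proof -
  have ne: "(UNIV :: (real^'a) set) \<noteq> {0}"
    using norm_axis_1 by (metis UNIV_I norm_zero singletonD zero_neq_one)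
  have lin: "linear (\<lambda>x. - (M *v x))"
    by (simp add: linear_compose_neg)
  obtain e \<mu> where e: "norm e = 1" "- (M *v e) = \<mu> *\<^sub>R e"
    and min: "\<And>y. \<mu> * (norm y)\<^sup>2 \<le> y \<bullet> - (M *v y)"
    using minimal_eigenvector[OF lin subspace_UNIV ne] symmetric_matrix_inner[OF assms]
    by (metis (no_types, lifting) UNIV_I inner_minus_right)
  have "M *v e = (- \<mu>) *\<^sub>R e" using e(2) by (metis minus_equation_iff scaleR_minus_left)
  then have "- \<mu> \<in> eigenvalues M" using e(1) unfolding eigenvalues_def
    by (metis (mono_tags, lifting) mem_Collect_eq norm_zero zero_neq_one)
  then have "- \<mu> \<le> max_eigenvalue M"
    unfolding max_eigenvalue_def using finite_eigenvalues[OF assms] by simp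
  then have "- \<mu> * (norm x)\<^sup>2 \<le> max_eigenvalue M * (norm x)\<^sup>2" by (intro mult_right_mono) auto
  then show ?thesis using min[of x] by simp
qed

text \<open>
  The sorted list of eigenvalues starts with as many zeros as the kernel has dimensions. If
  its entry at position \<open>k\<close>, counted from 0, is positive, there are at most \<open>k\<close> zeros, and
  every nonzero eigenvalue stands at this position or after it.
\<close>
lemma nth_eigenvalue_le_of_kernel_dim:
  assumes psd: "psd_matrix (M :: real^'a^'a)" and k: "1 \<le> k" "k \<le> dim (eigenspace M 0)"
    and pos: "nth_eigenvalue (k + 1) M > 0"
  shows "dim (eigenspace M 0) = k"
    and "\<And>\<mu>. \<mu> \<in> eigenvalues M \<Longrightarrow> \<mu> \<noteq> 0 \<Longrightarrow> nth_eigenvalue (k + 1) M \<le> \<mu>"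
proof -
  let ?m = "\<lambda>\<mu>. dim (eigenspace M \<mu>)"
  have fin: "finite (eigenvalues M)" using psd finite_eigenvalues by (auto simp: psd_matrix_def)
  have nonneg: "0 \<le> \<mu>" if mu: "\<mu> \<in> eigenvalues M" for \<mu>
  proof -
    obtain x where x: "x \<noteq> 0" "M *v x = \<mu> *\<^sub>R x" using mu by (auto simp: eigenvalues_def)
    have "0 \<le> x \<bullet> (M *v x)" using psd by (simp add: psd_matrix_def)
    then have "0 \<le> \<mu> * (x \<bullet> x)" by (simp add: x)
    moreover have "0 < x \<bullet> x" using x(1) by simp
    ultimately show ?thesis using mult_neg_pos[of \<mu> "x \<bullet> x"] by linarith
  qed
  have "0 \<in> eigenvalues M"
  proof (rule ccontr)
    assume "0 \<notin> eigenvalues M"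
    then have "eigenspace M 0 \<subseteq> {0}" by (auto simp: eigenvalues_def eigenspace_def)
    then have "dim (eigenspace M 0) = 0" by (simp add: dim_eq_0)
    then show False using k by linarith
  qed
  define ys where "ys = sorted_list_of_set (eigenvalues M - {0})"
  have "Min (eigenvalues M) = 0"
    using \<open>0 \<in> eigenvalues M\<close> fin nonneg by (intro Min_eqI) auto
  then have xs: "sorted_list_of_set (eigenvalues M) = 0 # ys"
    unfolding ys_def using \<open>0 \<in> eigenvalues M\<close> fin sorted_list_of_set_nonempty[of "eigenvalues M"]
    by auto
  have ys: "set ys = eigenvalues M - {0}" "sorted ys" using fin by (auto simp: ys_def)
  have se: "sorted_eigenvalues M = replicate (?m 0) 0 @ concat (map (\<lambda>\<mu>. replicate (?m \<mu>) \<mu>) ys)"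
    by (simp add: sorted_eigenvalues_def xs)
  have "\<not> k < ?m 0"
    using pos by (auto simp: nth_eigenvalue_def se nth_append)
  then show m0: "?m 0 = k" using k by simp
  fix \<mu> assume \<mu>: "\<mu> \<in> eigenvalues M" "\<mu> \<noteq> 0"
  then obtain y zs where yz: "ys = y # zs" using ys by (cases ys) auto
  then have "y \<in> eigenvalues M" using ys by auto
  then obtain x where x: "x \<noteq> 0" "x \<in> eigenspace M y" by (auto simp: eigenvalues_def eigenspace_def)
  then have "?m y \<noteq> 0" by (auto simp: dim_eq_0)
  then have "nth_eigenvalue (k + 1) M = y"
    by (cases "?m y") (auto simp: nth_eigenvalue_def se nth_append m0 yz)
  moreover have "\<mu> \<in> set ys" using ys(1) \<mu> by simp
  ultimately show "nth_eigenvalue (k + 1) M \<le> \<mu>" using ys(2) by (auto simp: yz)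
qed

text \<open>
  By the dimension count \<open>K\<close> is the whole kernel, so the smallest eigenvalue of \<open>M\<close> on the
  invariant subspace orthogonal to \<open>K\<close> is not zero.
\<close>
lemma nth_eigenvalue_le_Rayleigh:
  assumes psd: "psd_matrix (M :: real^'a^'a)" and K: "subspace K" "\<And>x. x \<in> K \<Longrightarrow> M *v x = 0" "1 \<le> dim K"
    and pos: "nth_eigenvalue (dim K + 1) M > 0"
    and x: "\<And>y. y \<in> K \<Longrightarrow> x \<bullet> y = 0"
  shows "nth_eigenvalue (dim K + 1) M * (norm x)\<^sup>2 \<le> x \<bullet> (M *v x)"
proof -
  let ?ev = "nth_eigenvalue (dim K + 1) M"
  have sub: "K \<subseteq> eigenspace M 0" using K by (auto simp: eigenspace_def)
  note gap = nth_eigenvalue_le_of_kernel_dim[OF psd K(3) dim_subset[OF sub] pos]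
  have "subspace (eigenspace M 0)" by (auto simp: subspace_def eigenspace_def algebra_simps)
  then have ker: "K = eigenspace M 0"
    using subspace_dim_equal[OF K(1) _ sub] gap(1) by simp
  define U where "U = {x. \<forall>y\<in>K. x \<bullet> y = 0}"
  have U: "subspace U" "x \<in> U"
    using x by (auto simp: subspace_def U_def inner_add_left)
  show ?thesis
  proof (cases "x = 0")
    case False
    then have ne: "U \<noteq> {0}" using U by auto
    have sym: "x \<bullet> (M *v y) = y \<bullet> (M *v x)" for x y
      using psd symmetric_matrix_inner by (auto simp: psd_matrix_def)
    have inv: "M *v z \<in> U" if "z \<in> U" for z
      using that sym[of _ z] K(2) by (auto simp: U_def inner_commute[of "M *v z"])
    obtain e \<mu> where e: "e \<in> U" "norm e = 1" "M *v e = \<mu> *\<^sub>R e"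
      and low: "\<And>y. y \<in> U \<Longrightarrow> \<mu> * (norm y)\<^sup>2 \<le> y \<bullet> (M *v y)"
      using minimal_eigenvector[OF matrix_vector_mul_linear U(1) ne inv sym] by blast
    have "e \<noteq> 0" using e(2) by auto
    then have "\<mu> \<in> eigenvalues M" using e(3) by (auto simp: eigenvalues_def)
    moreover have "\<mu> \<noteq> 0"
    proof
      assume "\<mu> = 0"
      then have "e \<in> K" using e by (simp add: ker eigenspace_def)
      then have "e \<bullet> e = 0" using e(1) by (auto simp: U_def)
      then show False using e(2) by simp
    qed
    ultimately have "?ev * (norm x)\<^sup>2 \<le> \<mu> * (norm x)\<^sup>2"
      using gap(2) by (intro mult_right_mono) auto
    also have "\<dots> \<le> x \<bullet> (M *v x)" by (rule low[OF U(2)])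
    finally show ?thesis .
  qed simp
qed

section \<open>Polar decomposition\<close>

text \<open>
  \<open>S\<^sup>T S\<close> is an orthogonal projection, so \<open>\<parallel>M\<parallel>\<^sup>2 - \<parallel>S M\<parallel>\<^sup>2\<close> is the squared norm of
  \<open>M - S\<^sup>T S M\<close>.
\<close>
lemma norm_stiefel_mult_le:
  fixes S :: "real^'p^'d" and M :: "real^'m^'p"
  assumes "S ** transpose S = mat 1"
  shows "norm (S ** M) \<le> norm M"
proof -
  let ?PM = "transpose S ** (S ** M)"
  have 1: "(S ** M) \<bullet> (S ** M) = M \<bullet> ?PM" by (rule inner_mult_left_adjoint)
  have "?PM \<bullet> ?PM = (S ** M) \<bullet> (S ** ?PM)" by (simp add: inner_mult_left_adjoint)
  also have "S ** ?PM = S ** M" using assms by (simp add: matrix_mul_assoc)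
  finally have "(M - ?PM) \<bullet> (M - ?PM) = M \<bullet> M - (S ** M) \<bullet> (S ** M)"
    by (simp add: inner_diff_left inner_diff_right 1 inner_commute)
  then have "(S ** M) \<bullet> (S ** M) \<le> M \<bullet> M" using inner_ge_zero[of "M - ?PM"] by linarith
  then show ?thesis by (simp add: norm_eq_sqrt_inner)
qed

lemma inner_mat_1_mat_1: "(mat 1 :: real^'d^'d) \<bullet> mat 1 = real CARD('d)"
  unfolding trace_eq_inner_mat[symmetric] by (simp add: trace_def mat_def)

lemma norm_stiefel: "norm (S :: real^'p^'d) = sqrt (real CARD('d))" if "S ** transpose S = mat 1"
proof -
  have "S \<bullet> S = mat 1 \<bullet> (S ** transpose S)"
    using inner_mult_right_adjoint[of "mat 1" S S] by simp
  then show ?thesis using that by (simp add: norm_eq_sqrt_inner inner_mat_1_mat_1)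
qed

lemma compact_stiefel: "compact (stiefel :: (real^'p^'d) set)"
proof -
  have "closed (stiefel :: (real^'p^'d) set)"
  proof -
    have "continuous_on UNIV (\<lambda>X::real^'p^'d. X ** transpose X)"
      by (intro bounded_bilinear.continuous_on[OF bounded_bilinear_matrix_mult] continuous_on_id
          linear_continuous_on linear_transpose[THEN linear_conv_bounded_linear[THEN iffD1]])
    then have "closed ((\<lambda>X::real^'p^'d. X ** transpose X) -` {mat 1})"
      by (intro closed_vimage) auto
    then show ?thesis by (simp add: stiefel_def vimage_def)
  qed
  moreover have "bounded (stiefel :: (real^'p^'d) set)"
    unfolding bounded_iff by (auto simp: stiefel_def dest!: norm_stiefel)
  ultimately show ?thesis by (simp add: compact_eq_bounded_closed)
qed

lemma stiefel_nonempty: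
  assumes "CARD('d::finite) \<le> CARD('p::finite)"
  shows "(stiefel :: (real^'p^'d) set) \<noteq> {}"
proof -
  obtain g :: "'d \<Rightarrow> 'p" where g: "inj g"
    using card_le_inj[of "UNIV :: 'd set" "UNIV :: 'p set"] assms by auto
  have "(\<chi> a. axis (g a) 1) ** transpose (\<chi> a. axis (g a) 1) = (mat 1 :: real^'d^'d)"
    using g by (simp add: vec_eq_iff matrix_matrix_mult_def transpose_def mat_def axis_def inj_eq
        if_distrib[of "\<lambda>x. x * _"] cong: if_cong)
  then have "((\<chi> a. axis (g a) 1) :: real^'p^'d) \<in> stiefel" by (simp add: stiefel_def)
  then show ?thesis by blast
qed

lemma inner_outer_product:
  "(M :: real^'d^'d) \<bullet> (\<chi> a b. y $ a * y $ b) = y \<bullet> (M *v y)"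
  by (simp add: inner_matrix_eq_sum inner_vec_def matrix_vector_mult_def sum_distrib_left mult_ac)

lemma reflection_orthogonal:
  fixes y :: "real^'d"
  assumes "norm y = 1"
  defines "R \<equiv> mat 1 - 2 *\<^sub>R (\<chi> a b. y $ a * y $ b)"
  shows "R ** transpose R = mat 1"
proof -
  let ?Y = "(\<chi> a b. y $ a * y $ b) :: real^'d^'d"
  have "(\<Sum>k\<in>UNIV. y $ k * y $ k) = 1"
    using assms(1) by (simp add: norm_eq_1 inner_vec_def)
  then have "?Y ** ?Y = ?Y"
    by (simp add: vec_eq_iff matrix_matrix_mult_def mult_ac sum_distrib_left[symmetric])
  moreover have "transpose R = R"
    by (simp add: R_def vec_eq_iff transpose_def mat_def mult.commute)
  ultimately show ?thesis
    unfolding R_def by (simp add: linear_diff[OF linear_mult_left] linear_diff[OF linear_mult_right]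
        linear_cmul[OF linear_mult_left] linear_cmul[OF linear_mult_right]) (simp add: vec_eq_iff)
qed

lemma stiefel_mult_orthogonal:
  assumes "K ** transpose K = mat 1" "R ** transpose R = mat 1"
  shows "(R ** K) ** transpose (R ** K) = (mat 1 :: real^'d^'d)"
proof -
  have "(R ** K) ** transpose (R ** K) = R ** (K ** transpose K) ** transpose R"
    by (simp add: matrix_transpose_mul matrix_mul_assoc)
  then show ?thesis using assms by simp
qed

text \<open>
  The orthonormal factor \<open>K\<close> is a matrix with orthonormal rows that maximises \<open>\<langle>X, K\<rangle>\<close>. Moving
  \<open>K\<close> along \<open>K exp(t \<Omega>)\<close> shows that \<open>K\<^sup>T X\<close> is symmetric, and this single fact gives both
  \<open>X = (K X\<^sup>T) K\<close> and the symmetry of \<open>H = K X\<^sup>T\<close>. Comparing \<open>K\<close> with its reflections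
  \<open>(I - 2 y y\<^sup>T) K\<close> gives \<open>y\<^sup>T H y \<ge> 0\<close>. In this way singular values are avoided, and \<open>X\<close> may
  have any rank.
\<close>
lemma polar_decomposition:
  fixes X :: "real^'p^'d"
  assumes "CARD('d) \<le> CARD('p)"
  obtains K H where "K ** transpose K = mat 1" "X = H ** K" "transpose H = H"
    "\<And>y. 0 \<le> y \<bullet> (H *v y)"
proof -
  have "continuous_on stiefel (\<lambda>K. X \<bullet> K)" by (intro continuous_intros)
  then obtain K where K: "K \<in> stiefel" and max: "\<And>Y. Y \<in> stiefel \<Longrightarrow> X \<bullet> Y \<le> X \<bullet> K"
    using continuous_attains_sup[OF compact_stiefel stiefel_nonempty[OF assms]] by blast
  have KK: "K ** transpose K = mat 1" using K by (simp add: stiefel_def)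
  \<comment> \<open>The first-order condition of the maximisation, along the curve \<open>K exp(t \<Omega>)\<close>.\<close>
  have crit: "(transpose K ** X) \<bullet> \<Omega> = 0" if \<Omega>: "transpose \<Omega> = - \<Omega>" for \<Omega>
  proof -
    let ?f = "\<lambda>Y::real^'p^'d. Y ** \<Omega>"
    have der: "(flow ?f K has_vector_derivative flow ?f K t ** \<Omega>) (at t)" for t
      by (rule flow_has_vector_derivative[OF linear_mult_right])
    have "flow ?f K t \<in> stiefel" for t
      using quadratic_conserved_by_skew_flow[OF der \<Omega>, of t] by (simp add: flow_0 stiefel_def KK)
    then have *: "X \<bullet> flow ?f K t \<le> X \<bullet> K" for t using max by blast
    have "((\<lambda>t. X \<bullet> flow ?f K t) has_real_derivative X \<bullet> (K ** \<Omega>)) (at 0)"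
      using bounded_linear.has_vector_derivative[OF bounded_linear_inner_right der, of X 0]
      by (simp add: has_real_derivative_iff_has_vector_derivative flow_0)
    then have "X \<bullet> (K ** \<Omega>) = 0"
      by (rule DERIV_local_max[of _ _ _ 1]) (auto simp: flow_0 *)
    then show ?thesis
      using inner_mult_left_adjoint[of K \<Omega> X] by (simp add: inner_commute)
  qed
  let ?W = "transpose K ** X"
  have tW: "transpose ?W = transpose X ** K" by (simp add: matrix_transpose_mul)
  \<comment> \<open>Taking \<open>\<Omega> = W - W\<^sup>T\<close> gives \<open>\<parallel>W - W\<^sup>T\<parallel>\<^sup>2 = 0\<close>.\<close>
  have skew: "transpose (?W - transpose ?W) = - (?W - transpose ?W)"
    by (simp add: linear_diff[OF linear_transpose])
  have "transpose ?W \<bullet> (?W - transpose ?W) = ?W \<bullet> transpose (?W - transpose ?W)"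
    using inner_transpose_transpose[of ?W "transpose (?W - transpose ?W)"] by simp
  then have "(?W - transpose ?W) \<bullet> (?W - transpose ?W) = 0"
    using crit[OF skew] unfolding skew by (simp add: inner_diff_left inner_diff_right)
  then have sym: "?W = transpose X ** K" using tW by simp
  define H where "H = K ** transpose X"
  have XHK: "X = H ** K"
  proof -
    have "X = K ** transpose K ** X" by (simp add: KK)
    also have "\<dots> = K ** (transpose X ** K)" unfolding sym[symmetric] by (simp add: matrix_mul_assoc)
    finally show ?thesis by (simp add: H_def matrix_mul_assoc)
  qed
  have HXK: "H = X ** transpose K"
  proof -
    have "X ** transpose K = H ** (K ** transpose K)" by (subst XHK) (simp add: matrix_mul_assoc)
    then show ?thesis by (simp add: KK)
  qed
  have tH: "transpose H = H"
    using HXK by (simp add: H_def matrix_transpose_mul)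
  have unit: "0 \<le> y \<bullet> (H *v y)" if y: "norm y = 1" for y
  proof -
    let ?Y = "(\<chi> a b. y $ a * y $ b) :: real^'d^'d"
    let ?R = "mat 1 - 2 *\<^sub>R ?Y"
    have "?R ** K \<in> stiefel"
      using stiefel_mult_orthogonal[OF KK reflection_orthogonal[OF y]] by (simp add: stiefel_def)
    from max[OF this] have "X \<bullet> (?R ** K) \<le> X \<bullet> K" .
    also have "X \<bullet> (?R ** K) = X \<bullet> K - 2 * (X \<bullet> (?Y ** K))"
      by (simp add: linear_diff[OF linear_mult_right] linear_cmul[OF linear_mult_right] inner_diff_right)
    finally have "0 \<le> X \<bullet> (?Y ** K)" by simp
    also have "\<dots> = (X ** transpose K) \<bullet> ?Y"
      using inner_mult_right_adjoint[of ?Y K X] by (simp add: inner_commute)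
    finally show ?thesis by (simp add: HXK[symmetric] inner_outer_product)
  qed
  have "0 \<le> y \<bullet> (H *v y)" for y
  proof (cases "y = 0")
    case False
    then have "0 \<le> (y /\<^sub>R norm y) \<bullet> (H *v (y /\<^sub>R norm y))" by (intro unit) simp
    then have "0 \<le> (inverse (norm y))\<^sup>2 * (y \<bullet> (H *v y))"
      by (simp add: matrix_vector_mult_scaleR power2_eq_square mult_ac)
    then show ?thesis using False by (simp add: zero_le_mult_iff)
  qed simp
  with KK XHK tH that show ?thesis by blast
qed

lemma psd_inner_gram_nonneg:
  fixes H :: "real^'d^'d" and G :: "real^'m^'d"
  assumes "\<And>y. 0 \<le> y \<bullet> (H *v y)"
  shows "0 \<le> H \<bullet> (G ** transpose G)"
proof -
  have "H \<bullet> (G ** transpose G) = transpose (H ** G) \<bullet> transpose G"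
    by (metis inner_mult_right_adjoint inner_commute inner_transpose_transpose)
  also have "\<dots> = (\<Sum>k\<in>UNIV. (H *v (transpose G $ k)) \<bullet> (transpose G $ k))"
    by (simp add: inner_vec_def transpose_def matrix_matrix_mult_def matrix_vector_mult_def)
  finally show ?thesis using assms by (simp add: sum_nonneg inner_commute)
qed

text \<open>
  Pair \<open>H\<close> with the Gram matrix of \<open>N\<^sup>T - N\<close>; this is a noncommutative form of
  \<open>2 x y \<le> x\<^sup>2 + y\<^sup>2\<close>.
\<close>
lemma psd_inner_square_le:
  fixes H N :: "real^'d^'d"
  assumes "\<And>y. 0 \<le> y \<bullet> (H *v y)" "transpose H = H"
  shows "2 * (H \<bullet> (N ** N)) \<le> H \<bullet> (N ** transpose N) + H \<bullet> (transpose N ** N)"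
proof -
  have "H \<bullet> (transpose N ** transpose N) = H \<bullet> (N ** N)"
    using inner_transpose_transpose[of H "N ** N"] assms(2) by (simp add: matrix_transpose_mul)
  moreover have "0 \<le> H \<bullet> ((transpose N - N) ** transpose (transpose N - N))"
    by (rule psd_inner_gram_nonneg[OF assms(1)])
  ultimately show ?thesis
    by (simp add: linear_diff[OF linear_transpose] linear_diff[OF linear_mult_left]
        linear_diff[OF linear_mult_right] inner_diff_right)
qed

section \<open>Sums over an orthonormal basis of matrices\<close>

text \<open>
  The sums below play the part of Gaussian expectations: for a quadratic form, the sum over an
  orthonormal basis and the expectation over a standard Gaussian matrix are both the trace.
\<close>
lemma sum_Basis_matrix: "(\<Sum>\<Phi>\<in>(Basis :: (real^'p^'d) set). f \<Phi>) = (\<Sum>a\<in>UNIV. \<Sum>b\<in>UNIV. f (axis a (axis b 1)))"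
proof -
  let ?g = "\<lambda>(a, b). axis a (axis b 1) :: real^'p^'d"
  have inj: "inj_on ?g (UNIV \<times> UNIV)"
    by (auto intro!: inj_onI simp: axis_eq_axis)
  have basis: "(Basis :: (real^'p^'d) set) = ?g ` (UNIV \<times> UNIV)"
    by (auto simp: Basis_vec_def image_iff)
  show ?thesis
    unfolding basis sum.reindex[OF inj] sum.cartesian_product by (simp add: o_def case_prod_beta)
qed

lemma axis_axis_inner: "axis a (axis b 1) \<bullet> (X :: real^'p^'d) = X $ a $ b"
  by (simp add: inner_axis')

lemma axis_axis_nth: "(axis a (axis b 1) :: real^'p^'d) $ k $ l = (if k = a then if l = b then 1 else 0 else 0)"
  by (simp add: axis_def)

lemma sum_mult_delta:
  fixes f :: "'b::finite \<Rightarrow> real"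
  shows "(\<Sum>k\<in>UNIV. f k * (if k = a then c else 0)) = f a * c"
    and "(\<Sum>k\<in>UNIV. (if k = a then c else 0) * f k) = c * f a"
  by (simp_all add: if_distrib if_distribR cong: if_cong)

lemma sum_Basis_mult_mult:
  fixes A :: "real^'d^'d" and B :: "real^'p^'p"
  shows "(\<Sum>\<Phi>\<in>Basis. \<Phi> \<bullet> (A ** \<Phi> ** B)) = trace A * trace B"
proof -
  have 1: "(A ** axis a (axis b 1)) $ i $ l = (if l = b then A $ i $ a else 0)" for a i :: 'd and b l :: 'p
    by (simp add: matrix_matrix_mult_def axis_axis_nth sum_mult_delta)
  have "(A ** axis a (axis b 1) ** B) $ a $ b = A $ a $ a * B $ b $ b" for a :: 'd and b :: 'p
    unfolding matrix_matrix_mult_def[of "A ** axis a (axis b 1)"] by (simp add: 1 sum_mult_delta)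
  then show ?thesis by (simp add: sum_Basis_matrix axis_axis_inner trace_def sum_product)
qed

lemma sum_Basis_mult_transpose_mult:
  fixes A B :: "real^'p^'d"
  shows "(\<Sum>\<Phi>\<in>Basis. \<Phi> \<bullet> (A ** transpose \<Phi> ** B)) = A \<bullet> B"
proof -
  have 0: "transpose (axis a (axis b 1) :: real^'p^'d) = axis b (axis a 1)" for a b
    by (simp add: transpose_def axis_axis_nth vec_eq_iff)
  have 1: "(A ** axis b (axis a 1)) $ i $ l = (if l = a then A $ i $ b else 0)" for a i l :: 'd and b :: 'p
    by (simp add: matrix_matrix_mult_def axis_axis_nth sum_mult_delta)
  have "(A ** transpose (axis a (axis b 1)) ** B) $ a $ b = A $ a $ b * B $ a $ b" for a :: 'd and b :: 'p
    unfolding 0 matrix_matrix_mult_def[of "A ** axis b (axis a 1)"] by (simp add: 1 sum_mult_delta)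
  then show ?thesis by (simp add: sum_Basis_matrix axis_axis_inner inner_matrix_eq_sum[of A])
qed

lemma sum_Basis_mult_right:
  fixes B :: "real^'p^'p"
  shows "(\<Sum>\<Phi>\<in>(Basis :: (real^'p^'d) set). \<Phi> \<bullet> (\<Phi> ** B)) = real CARD('d) * trace B"
  using sum_Basis_mult_mult[of "mat 1 :: real^'d^'d" B] by (simp add: trace_eq_inner_mat inner_mat_1_mat_1)

section \<open>Test directions for the Hessian\<close>

abbreviation row_proj :: "real^'p^'d \<Rightarrow> real^'p^'p" where
  "row_proj S \<equiv> transpose S ** S"

text \<open>
  The test direction at \<open>\<Phi>\<close> without its summand \<open>\<Phi>\<close>. That summand does not depend on the
  block, so the certificate matrix annihilates it.
\<close>
definition direction_offset :: "real \<Rightarrow> real^'p^'d \<Rightarrow> real^'p^'d \<Rightarrow> real^'p^'d" where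
  "direction_offset \<tau> S \<Phi> = - (1 - \<tau>) *\<^sub>R (\<Phi> ** row_proj S) - \<tau> *\<^sub>R (S ** transpose \<Phi> ** S)"

text \<open>
  At \<open>\<tau> = 1/2\<close> this is the orthogonal projection of \<open>\<Phi>\<close> onto the tangent space at \<open>S\<close>; in
  general \<open>\<tau>\<close> weighs its component inside the row space of \<open>S\<close>, see \<open>direction_decomp\<close>.
\<close>
definition direction :: "real \<Rightarrow> real^'p^'d \<Rightarrow> real^'p^'d \<Rightarrow> real^'p^'d" where
  "direction \<tau> S \<Phi> = \<Phi> + direction_offset \<tau> S \<Phi>"

lemma linear_direction_offset: "linear (direction_offset \<tau> S)"
  by (rule linearI) (simp_all add: direction_offset_def linear_add[OF linear_transpose] linear_cmul[OF linear_transpose]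
    linear_add[OF linear_mult_right] linear_add[OF linear_mult_left] linear_cmul[OF linear_mult_left]
    linear_cmul[OF linear_mult_right] algebra_simps)

lemma trace_row_proj_mult: "trace (row_proj S ** row_proj T) = row_proj S \<bullet> row_proj T"
  unfolding trace_eq_inner_mat
  by (simp add: inner_mult_right_adjoint matrix_transpose_mul)

lemma trace_mult_transpose: "trace (S ** transpose T) = S \<bullet> T"
  unfolding trace_eq_inner_mat by (simp add: inner_mult_right_adjoint)

lemma trace_transpose_mult: "trace (transpose S ** T) = S \<bullet> T"
  using inner_mult_left_adjoint[of "transpose S" T "mat 1"] by (simp add: trace_eq_inner_mat inner_commute)

text \<open>
  This is where \<open>q\<close> comes from: \<open>q(\<tau>) = d (1 - \<tau>)\<^sup>2 + 2 \<tau> (1 - \<tau>)\<close> collects the square of the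
  first summand of the direction and the two mixed terms, all of which produce \<open>\<langle>P, Q\<rangle>\<close> for
  the row projections \<open>P\<close> and \<open>Q\<close> of \<open>S\<close> and \<open>T\<close>.
\<close>
lemma sum_Basis_direction_offset_inner:
  fixes S T :: "real^'p^'d"
  shows "(\<Sum>\<Phi>\<in>Basis. direction_offset \<tau> S \<Phi> \<bullet> direction_offset \<tau> T \<Phi>) =
    q_fun CARD('d) \<tau> * (row_proj S \<bullet> row_proj T) + \<tau>\<^sup>2 * (S \<bullet> T)\<^sup>2"
proof -
  let ?P = "row_proj S" and ?Q = "row_proj T"
  have 1: "(\<Phi> ** ?P) \<bullet> (\<Phi> ** ?Q) = \<Phi> \<bullet> (\<Phi> ** (?Q ** ?P))" for \<Phi> :: "real^'p^'d"
    by (simp add: inner_mult_right_adjoint matrix_transpose_mul matrix_mul_assoc)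
  have 2: "(\<Phi> ** ?P) \<bullet> (T ** transpose \<Phi> ** T) = \<Phi> \<bullet> (T ** transpose \<Phi> ** (T ** ?P))" for \<Phi> :: "real^'p^'d"
    by (simp add: inner_mult_right_adjoint matrix_transpose_mul matrix_mul_assoc)
  have 3: "(S ** transpose \<Phi> ** S) \<bullet> (\<Phi> ** ?Q) = \<Phi> \<bullet> (S ** transpose \<Phi> ** (S ** ?Q))" for \<Phi> :: "real^'p^'d"
    by (simp add: inner_mult_right_adjoint matrix_transpose_mul matrix_mul_assoc inner_commute[of _ "\<Phi> ** ?Q"]
        inner_commute[of _ "\<Phi> ** transpose T ** T"])
  have 4: "(S ** transpose \<Phi> ** S) \<bullet> (T ** transpose \<Phi> ** T) =
      \<Phi> \<bullet> ((S ** transpose T) ** \<Phi> ** (transpose T ** S))" for \<Phi> :: "real^'p^'d"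
  proof -
    have "(S ** transpose \<Phi> ** S) \<bullet> (T ** transpose \<Phi> ** T) =
      transpose \<Phi> \<bullet> (transpose S ** (T ** transpose \<Phi> ** T ** transpose S))"
      by (simp only: matrix_mul_assoc[symmetric] inner_mult_left_adjoint[of S]
          inner_mult_right_adjoint[of "transpose \<Phi>" S])
    also have "\<dots> = \<Phi> \<bullet> transpose (transpose S ** (T ** transpose \<Phi> ** T ** transpose S))"
      using inner_transpose_transpose[of "transpose \<Phi>"] by (metis transpose_transpose)
    finally show ?thesis by (simp add: matrix_transpose_mul matrix_mul_assoc)
  qed
  have s2: "(\<Sum>\<Phi>\<in>Basis. (\<Phi> ** ?P) \<bullet> (T ** transpose \<Phi> ** T)) = ?P \<bullet> ?Q"
    unfolding 2 sum_Basis_mult_transpose_mult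
    using inner_mult_left_adjoint[of T ?P T] by (simp add: inner_commute)
  have s3: "(\<Sum>\<Phi>\<in>Basis. (S ** transpose \<Phi> ** S) \<bullet> (\<Phi> ** ?Q)) = ?P \<bullet> ?Q"
    unfolding 3 sum_Basis_mult_transpose_mult
    using inner_mult_left_adjoint[of S ?Q S] by (simp add: inner_commute)
  have s1: "(\<Sum>\<Phi>\<in>(Basis :: (real^'p^'d) set). (\<Phi> ** ?P) \<bullet> (\<Phi> ** ?Q)) = real CARD('d) * (?P \<bullet> ?Q)"
    unfolding 1 sum_Basis_mult_right trace_row_proj_mult by (simp add: inner_commute)
  have s4: "(\<Sum>\<Phi>\<in>Basis. (S ** transpose \<Phi> ** S) \<bullet> (T ** transpose \<Phi> ** T)) = (S \<bullet> T)\<^sup>2"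
    unfolding 4 sum_Basis_mult_mult trace_mult_transpose trace_transpose_mult by (simp add: inner_commute power2_eq_square)
  have "direction_offset \<tau> S \<Phi> \<bullet> direction_offset \<tau> T \<Phi> =
     (1 - \<tau>)\<^sup>2 * ((\<Phi> ** ?P) \<bullet> (\<Phi> ** ?Q)) + (1 - \<tau>) * \<tau> * ((\<Phi> ** ?P) \<bullet> (T ** transpose \<Phi> ** T))
     + (1 - \<tau>) * \<tau> * ((S ** transpose \<Phi> ** S) \<bullet> (\<Phi> ** ?Q))
     + \<tau>\<^sup>2 * ((S ** transpose \<Phi> ** S) \<bullet> (T ** transpose \<Phi> ** T))" for \<Phi>
    unfolding direction_offset_def
    by (simp only: inner_diff_left inner_diff_right inner_scaleR_left inner_scaleR_right
        inner_minus_left inner_minus_right power2_eq_square) (simp add: algebra_simps)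
  then have "(\<Sum>\<Phi>\<in>Basis. direction_offset \<tau> S \<Phi> \<bullet> direction_offset \<tau> T \<Phi>) =
     (1 - \<tau>)\<^sup>2 * (real CARD('d) * (?P \<bullet> ?Q)) + (1 - \<tau>) * \<tau> * (?P \<bullet> ?Q)
     + (1 - \<tau>) * \<tau> * (?P \<bullet> ?Q) + \<tau>\<^sup>2 * (S \<bullet> T)\<^sup>2"
    by (simp only: sum.distrib sum_distrib_left[symmetric] s1 s2 s3 s4)
  also have "\<dots> = q_fun CARD('d) \<tau> * (?P \<bullet> ?Q) + \<tau>\<^sup>2 * (S \<bullet> T)\<^sup>2"
    unfolding q_fun_def power2_eq_square by (simp add: algebra_simps)
  finally show ?thesis .
qed

lemma row_proj_projection:
  assumes "S ** transpose S = mat 1"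
  shows "row_proj S ** row_proj S = row_proj S"
    "(mat 1 - row_proj S) ** (mat 1 - row_proj S) = mat 1 - row_proj S"
    "(mat 1 - row_proj S) ** transpose S = 0"
    "transpose (mat 1 - row_proj S) = mat 1 - row_proj S"
proof -
  have "row_proj S ** row_proj S = transpose S ** (S ** transpose S) ** S"
    by (simp add: matrix_mul_assoc)
  then show 1: "row_proj S ** row_proj S = row_proj S" by (simp add: assms)
  show "(mat 1 - row_proj S) ** (mat 1 - row_proj S) = mat 1 - row_proj S"
    by (simp add: linear_diff[OF linear_mult_right] linear_diff[OF linear_mult_left] 1)
  show "(mat 1 - row_proj S) ** transpose S = 0"
    by (simp add: linear_diff[OF linear_mult_right] matrix_mul_assoc[symmetric] assms)
  show "transpose (mat 1 - row_proj S) = mat 1 - row_proj S"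
    by (simp add: linear_diff[OF linear_transpose] matrix_transpose_mul)
qed

lemma direction_decomp:
  fixes S \<Phi> :: "real^'p^'d"
  assumes "S ** transpose S = mat 1"
  shows "direction \<tau> S \<Phi> = \<Phi> ** (mat 1 - row_proj S) + \<tau> *\<^sub>R ((\<Phi> ** transpose S - S ** transpose \<Phi>) ** S)"
  by (simp add: direction_def direction_offset_def linear_diff[OF linear_mult_left] linear_diff[OF linear_mult_right]
     matrix_mul_assoc algebra_simps)

lemma direction_tangent:
  fixes S \<Phi> :: "real^'p^'d"
  assumes SS: "S ** transpose S = mat 1"
  shows "direction \<tau> S \<Phi> ** transpose S + S ** transpose (direction \<tau> S \<Phi>) = 0"
proof -
  let ?W = "\<Phi> ** transpose S - S ** transpose \<Phi>"
  have 1: "direction \<tau> S \<Phi> ** transpose S = \<tau> *\<^sub>R ?W"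
    unfolding direction_decomp[OF SS] matrix_mult_add_left linear_cmul[OF linear_mult_right]
    using linear_0[OF linear_mult_left[of \<Phi>]]
    by (simp add: matrix_mul_assoc[symmetric] SS row_proj_projection(3))
  have "S ** transpose (direction \<tau> S \<Phi>) = transpose (\<tau> *\<^sub>R ?W)"
    unfolding 1[symmetric] by (simp add: matrix_transpose_mul)
  also have "\<dots> = - (\<tau> *\<^sub>R ?W)"
    by (simp add: linear_cmul[OF linear_transpose] linear_diff[OF linear_transpose] matrix_transpose_mul algebra_simps)
  finally show ?thesis unfolding 1 by simp
qed

text \<open>
  This is where \<open>r\<close> comes from: the component of the direction outside the row space
  contributes \<open>p - d\<close>, the component \<open>\<tau> W S\<close> with skew \<open>W\<close> contributes \<open>2 (d - 1) \<tau>\<^sup>2\<close>, and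
  the two are orthogonal with respect to \<open>C\<close>.
\<close>
lemma sum_Basis_direction_quadratic:
  fixes S :: "real^'p^'d" and C :: "real^'d^'d"
  assumes SS: "S ** transpose S = mat 1" and C: "transpose C = C"
  shows "(\<Sum>\<Phi>\<in>Basis. direction \<tau> S \<Phi> \<bullet> (C ** direction \<tau> S \<Phi>)) = r_fun CARD('p) CARD('d) \<tau> * trace C"
proof -
  let ?R = "mat 1 - row_proj S"
  define W where "W \<Phi> = \<Phi> ** transpose S - S ** transpose \<Phi>" for \<Phi> :: "real^'p^'d"
  note R = row_proj_projection[OF SS]
  have RS: "S ** ?R = 0"
    by (simp add: linear_diff[OF linear_mult_left] matrix_mul_assoc SS)
  have cross: "(X ** S) \<bullet> (Y ** ?R) = 0" for X :: "real^'d^'d" and Y :: "real^'p^'d"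
  proof -
    have "(X ** S) \<bullet> (Y ** ?R) = (Y ** ?R) \<bullet> (X ** S)" by (rule inner_commute)
    also have "\<dots> = Y \<bullet> (X ** (S ** ?R))"
      by (simp add: inner_mult_right_adjoint R matrix_mul_assoc)
    finally show ?thesis unfolding RS using linear_0[OF linear_mult_left[of X]] by simp
  qed
  have a: "direction \<tau> S \<Phi> \<bullet> (C ** direction \<tau> S \<Phi>) =
     (\<Phi> ** ?R) \<bullet> (C ** (\<Phi> ** ?R)) + \<tau>\<^sup>2 * ((W \<Phi> ** S) \<bullet> (C ** (W \<Phi> ** S)))" for \<Phi>
  proof -
    have "(\<Phi> ** ?R) \<bullet> (C ** (W \<Phi> ** S)) = 0"
      using cross[of "C ** W \<Phi>" \<Phi>] by (simp add: matrix_mul_assoc inner_commute)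
    moreover have "(W \<Phi> ** S) \<bullet> (C ** (\<Phi> ** ?R)) = 0"
      using cross[of "W \<Phi>" "C ** \<Phi>"] by (simp add: matrix_mul_assoc)
    ultimately show ?thesis
      unfolding direction_decomp[OF SS] W_def[symmetric]
      by (simp add: matrix_add_ldistrib linear_cmul[OF linear_mult_left] inner_add_left inner_add_right
          power2_eq_square)
  qed
  have b: "(\<Phi> ** ?R) \<bullet> (C ** (\<Phi> ** ?R)) = \<Phi> \<bullet> (C ** \<Phi> ** ?R)" for \<Phi> :: "real^'p^'d"
  proof -
    have "(\<Phi> ** ?R) \<bullet> (C ** (\<Phi> ** ?R)) = \<Phi> \<bullet> (C ** \<Phi> ** (?R ** ?R))"
      by (simp only: inner_mult_right_adjoint R(4) matrix_mul_assoc)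
    then show ?thesis by (simp only: R(2))
  qed
  have trR: "trace ?R = real CARD('p) - real CARD('d)"
    using inner_mult_left_adjoint[of "transpose S" S "mat 1"] norm_stiefel[OF SS]
    by (simp add: trace_eq_inner_mat inner_diff_left inner_mat_1_mat_1 norm_eq_sqrt_inner)
  have c: "(W \<Phi> ** S) \<bullet> (C ** (W \<Phi> ** S)) = W \<Phi> \<bullet> (C ** W \<Phi>)" for \<Phi>
  proof -
    have "(W \<Phi> ** S) \<bullet> (C ** (W \<Phi> ** S)) = W \<Phi> \<bullet> (C ** W \<Phi> ** (S ** transpose S))"
      by (simp only: inner_mult_right_adjoint matrix_mul_assoc)
    then show ?thesis by (simp add: SS)
  qed
  have d1: "(\<Phi> ** transpose S) \<bullet> (C ** (\<Phi> ** transpose S)) = \<Phi> \<bullet> (C ** \<Phi> ** row_proj S)" for \<Phi> :: "real^'p^'d"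
    by (simp add: inner_mult_right_adjoint matrix_mul_assoc)
  have d2: "(\<Phi> ** transpose S) \<bullet> (C ** (S ** transpose \<Phi>)) = \<Phi> \<bullet> ((C ** S) ** transpose \<Phi> ** S)" for \<Phi> :: "real^'p^'d"
    by (simp add: inner_mult_right_adjoint matrix_mul_assoc)
  have d3: "(S ** transpose \<Phi>) \<bullet> (C ** (\<Phi> ** transpose S)) = \<Phi> \<bullet> ((C ** S) ** transpose \<Phi> ** S)" for \<Phi> :: "real^'p^'d"
  proof -
    have "(S ** transpose \<Phi>) \<bullet> (C ** (\<Phi> ** transpose S)) = (C ** (S ** transpose \<Phi>)) \<bullet> (\<Phi> ** transpose S)"
      by (simp only: inner_mult_left_adjoint[of C] C)
    then show ?thesis using d2[of \<Phi>] by (simp add: inner_commute)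
  qed
  have d4: "(S ** transpose \<Phi>) \<bullet> (C ** (S ** transpose \<Phi>)) = \<Phi> \<bullet> (\<Phi> ** (transpose S ** (C ** S)))" for \<Phi> :: "real^'p^'d"
  proof -
    have "(S ** transpose \<Phi>) \<bullet> (C ** (S ** transpose \<Phi>)) = transpose \<Phi> \<bullet> (transpose S ** (C ** S) ** transpose \<Phi>)"
      by (simp add: inner_mult_left_adjoint matrix_mul_assoc)
    also have "\<dots> = \<Phi> \<bullet> transpose (transpose S ** (C ** S) ** transpose \<Phi>)"
      using inner_transpose_transpose[of "transpose \<Phi>"] by (metis transpose_transpose)
    finally show ?thesis by (simp add: matrix_transpose_mul C matrix_mul_assoc)
  qed
  have trP: "trace (row_proj S) = real CARD('d)"
    using trace_transpose_mult[of S S] norm_stiefel[OF SS] by (simp add: norm_eq_sqrt_inner)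
  have CS: "(C ** S) \<bullet> S = trace C"
    using inner_mult_right_adjoint[of C S S] by (simp add: trace_eq_inner_mat SS)
  have tSCS: "trace (transpose S ** (C ** S)) = trace C"
    unfolding trace_transpose_mult using CS by (simp add: inner_commute)
  have e: "W \<Phi> \<bullet> (C ** W \<Phi>) = (\<Phi> ** transpose S) \<bullet> (C ** (\<Phi> ** transpose S))
     - (\<Phi> ** transpose S) \<bullet> (C ** (S ** transpose \<Phi>)) - (S ** transpose \<Phi>) \<bullet> (C ** (\<Phi> ** transpose S))
     + (S ** transpose \<Phi>) \<bullet> (C ** (S ** transpose \<Phi>))" for \<Phi>
    by (simp add: W_def linear_diff[OF linear_mult_left] inner_diff_left inner_diff_right)
  have W: "(\<Sum>\<Phi>\<in>Basis. W \<Phi> \<bullet> (C ** W \<Phi>)) = 2 * (real CARD('d) - 1) * trace C"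
    unfolding e d1 d2 d3 d4 sum.distrib sum_subtractf sum_Basis_mult_mult sum_Basis_mult_transpose_mult
      sum_Basis_mult_right tSCS trP CS by (simp add: algebra_simps)
  show ?thesis
    unfolding a b c sum.distrib sum_distrib_left[symmetric] W sum_Basis_mult_mult trR r_fun_def
    by (simp add: algebra_simps)
qed

section \<open>Concentration of row spaces and of blocks\<close>

text \<open>
  The left-hand side is the squared norm of the component of \<open>C\<close> in the plane spanned by the
  orthogonal vectors \<open>P\<close> and \<open>J - P\<close>. In the applications \<open>P\<close> is an orthogonal projection of
  rank \<open>k\<close> and \<open>J\<close> the identity matrix of size \<open>m\<close>.
\<close>
lemma two_level_norm_bound:
  fixes C P J :: "'a::real_inner"
  assumes "P \<bullet> P = k" "P \<bullet> J = k" "J \<bullet> J = m" "0 < k" "k < m"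
  shows "(C \<bullet> P)\<^sup>2 / k + (C \<bullet> J - C \<bullet> P)\<^sup>2 / (m - k) \<le> C \<bullet> C"
proof -
  define Q a b where "Q = J - P" and "a = (C \<bullet> P) / k" and "b = (C \<bullet> J - C \<bullet> P) / (m - k)"
  have CP: "C \<bullet> P = a * k" "C \<bullet> Q = b * (m - k)"
    using assms by (auto simp: a_def b_def Q_def inner_diff_right)
  have QQ: "Q \<bullet> Q = m - k" "P \<bullet> Q = 0"
    using assms by (auto simp: Q_def inner_diff_left inner_diff_right inner_commute)
  let ?M = "C - a *\<^sub>R P - b *\<^sub>R Q"
  have "?M \<bullet> ?M = C \<bullet> C - 2 * a * (C \<bullet> P) - 2 * b * (C \<bullet> Q) + a\<^sup>2 * (P \<bullet> P)
      + 2 * a * b * (P \<bullet> Q) + b\<^sup>2 * (Q \<bullet> Q)"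
    by (simp add: inner_diff_left inner_diff_right inner_commute[of P C] inner_commute[of Q C] inner_commute[of Q P]
        power2_eq_square algebra_simps)
  also have "\<dots> = C \<bullet> C - a\<^sup>2 * k - b\<^sup>2 * (m - k)"
    unfolding CP QQ assms(1) by (simp add: power2_eq_square algebra_simps)
  finally have "a\<^sup>2 * k + b\<^sup>2 * (m - k) \<le> C \<bullet> C" using inner_ge_zero[of ?M] by linarith
  moreover have "a\<^sup>2 * k = (C \<bullet> P)\<^sup>2 / k" "b\<^sup>2 * (m - k) = (C \<bullet> J - C \<bullet> P)\<^sup>2 / (m - k)"
    using assms by (auto simp: a_def b_def power2_eq_square)
  ultimately show ?thesis by simp
qed

lemma outer_product_mult_vector: "(\<chi> a b. x $ a * x $ b) *v y = (x \<bullet> y) *\<^sub>R (x :: real^'m)"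
  by (simp add: vec_eq_iff matrix_vector_mult_def inner_vec_def sum_distrib_right mult_ac sum_distrib_left)

text \<open>
  \<open>\<Sum> \<langle>x\<^sub>i, x\<^sub>j\<rangle>\<^sup>2\<close> is the squared Frobenius norm of \<open>\<Sum> x\<^sub>i x\<^sub>i\<^sup>T\<close>, compared with the
  projection \<open>e e\<^sup>T\<close>.
\<close>
lemma sum_inner_squares_ge:
  fixes x :: "'n::finite \<Rightarrow> real^'m"
  assumes e: "norm e = 1" and m: "1 < CARD('m)"
  shows "(\<Sum>i\<in>UNIV. (x i \<bullet> e)\<^sup>2)\<^sup>2 + ((\<Sum>i\<in>UNIV. x i \<bullet> x i) - (\<Sum>i\<in>UNIV. (x i \<bullet> e)\<^sup>2))\<^sup>2 / (real CARD('m) - 1)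
     \<le> (\<Sum>i\<in>UNIV. \<Sum>j\<in>UNIV. (x i \<bullet> x j)\<^sup>2)"
proof -
  define out where "out y = (\<chi> a b. y $ a * y $ b)" for y :: "real^'m"
  have out_out: "out y \<bullet> out z = (y \<bullet> z)\<^sup>2" for y z
    unfolding out_def inner_outer_product outer_product_mult_vector
    by (simp add: inner_commute power2_eq_square)
  have out_1: "out y \<bullet> mat 1 = y \<bullet> y" for y
    using inner_outer_product[of "mat 1" y] by (simp add: out_def inner_commute)
  have e1: "e \<bullet> e = 1" using e by (simp add: norm_eq_1)
  have "((\<Sum>i\<in>UNIV. out (x i)) \<bullet> out e)\<^sup>2 / 1 +
      ((\<Sum>i\<in>UNIV. out (x i)) \<bullet> mat 1 - (\<Sum>i\<in>UNIV. out (x i)) \<bullet> out e)\<^sup>2 / (real CARD('m) - 1)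
      \<le> (\<Sum>i\<in>UNIV. out (x i)) \<bullet> (\<Sum>i\<in>UNIV. out (x i))"
    using m by (intro two_level_norm_bound) (auto simp: out_out out_1 e1 inner_mat_1_mat_1)
  also have "(\<Sum>i\<in>UNIV. out (x i)) \<bullet> (\<Sum>i\<in>UNIV. out (x i)) = (\<Sum>i\<in>UNIV. \<Sum>j\<in>UNIV. (x i \<bullet> x j)\<^sup>2)"
    by (simp add: inner_sum_left inner_sum_right out_out) (rule sum.swap)
  finally show ?thesis by (simp add: inner_sum_left out_out out_1)
qed

lemma sum_inner_squares_ge_matrix:
  fixes x :: "'n::finite \<Rightarrow> real^'p^'d"
  assumes e: "norm e = 1" and m: "1 < CARD('d) * CARD('p)"
  shows "(\<Sum>i\<in>UNIV. (x i \<bullet> e)\<^sup>2)\<^sup>2 +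
      ((\<Sum>i\<in>UNIV. x i \<bullet> x i) - (\<Sum>i\<in>UNIV. (x i \<bullet> e)\<^sup>2))\<^sup>2 / (real CARD('d) * real CARD('p) - 1)
     \<le> (\<Sum>i\<in>UNIV. \<Sum>j\<in>UNIV. (x i \<bullet> x j)\<^sup>2)"
proof -
  define vec where "vec y = (\<chi> r. y $ fst r $ snd r)" for y :: "real^'p^'d"
  have v: "vec y \<bullet> vec z = y \<bullet> z" for y z
    by (simp add: vec_def inner_vec_def[of "\<chi> r. _ r"] inner_matrix_eq_sum sum.cartesian_product case_prod_beta)
  then have "norm (vec e) = 1" using e by (simp add: norm_eq_sqrt_inner)
  from sum_inner_squares_ge[OF this, of "\<lambda>i. vec (x i)"] show ?thesis
    using m by (simp add: v)
qed

lemma inner_row_proj: "row_proj S \<bullet> row_proj K = (K ** transpose S) \<bullet> (K ** transpose S)"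
  for S :: "real^'p^'d" and K :: "real^'p^'e"
proof -
  have "(K ** transpose S) \<bullet> (K ** transpose S) = K \<bullet> (K ** row_proj S)"
    by (simp add: inner_mult_right_adjoint matrix_mul_assoc)
  also have "\<dots> = (transpose K ** K) \<bullet> row_proj S"
    using inner_mult_left_adjoint[of K "row_proj S" K] by (simp add: inner_commute)
  finally show ?thesis by (simp add: inner_commute)
qed

lemma inner_stiefel_self:
  fixes S :: "real^'p^'d"
  assumes "S ** transpose S = mat 1" shows "S \<bullet> S = real CARD('d)"
  using norm_stiefel[OF assms] by (simp add: norm_eq_sqrt_inner)

text \<open>
  The same comparison for \<open>\<Sum> P\<^sub>i\<close> and the projection \<open>K\<^sup>T K\<close> of rank \<open>d\<close>.
\<close>
lemma sum_row_proj_inner_ge: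
  fixes S :: "'n::finite \<Rightarrow> real^'p^'d" and K :: "real^'p^'d"
  assumes S: "\<And>i. S i ** transpose (S i) = mat 1" and K: "K ** transpose K = mat 1"
    and pd: "CARD('d) < CARD('p)"
  defines "a \<equiv> \<Sum>i\<in>UNIV. (norm (K ** transpose (S i)))\<^sup>2"
  shows "a\<^sup>2 / real CARD('d) + (real CARD('n) * real CARD('d) - a)\<^sup>2 / (real CARD('p) - real CARD('d))
    \<le> (\<Sum>i\<in>UNIV. \<Sum>j\<in>UNIV. row_proj (S i) \<bullet> row_proj (S j))"
proof -
  let ?C = "\<Sum>i\<in>UNIV. row_proj (S i)"
  have tr: "row_proj T \<bullet> mat 1 = real CARD('d)" if "T ** transpose T = mat 1" for T :: "real^'p^'d"
    using trace_transpose_mult[of T T] inner_stiefel_self[OF that] by (simp add: trace_eq_inner_mat)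
  have KK: "row_proj K \<bullet> row_proj K = real CARD('d)"
    unfolding inner_row_proj K by (rule inner_mat_1_mat_1)
  have a: "?C \<bullet> row_proj K = a"
    by (simp add: inner_sum_left inner_row_proj a_def power2_norm_eq_inner)
  have "(?C \<bullet> row_proj K)\<^sup>2 / real CARD('d) +
     (?C \<bullet> mat 1 - ?C \<bullet> row_proj K)\<^sup>2 / (real CARD('p) - real CARD('d)) \<le> ?C \<bullet> ?C"
    using pd by (intro two_level_norm_bound KK tr K inner_mat_1_mat_1) auto
  moreover have "?C \<bullet> ?C = (\<Sum>i\<in>UNIV. \<Sum>j\<in>UNIV. row_proj (S i) \<bullet> row_proj (S j))"
    by (simp add: inner_sum_left inner_sum_right) (rule sum.swap)
  moreover have "?C \<bullet> mat 1 = real CARD('n) * real CARD('d)" by (simp add: inner_sum_left tr S)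
  ultimately show ?thesis unfolding a by simp
qed

section \<open>The polar factor of the mean\<close>

text \<open>
  With a unit eigenvector \<open>e\<close> for the smallest eigenvalue \<open>\<sigma>\<close> and \<open>R = I - e e\<^sup>T\<close> one has
  \<open>\<parallel>X\<parallel>\<^sup>2 = \<parallel>H\<parallel>\<^sup>2 = \<sigma>\<^sup>2 + \<parallel>H R\<parallel>\<^sup>2\<close>. Since \<open>H = X K\<^sup>T\<close> is an average of contractions,
  \<open>\<parallel>H R\<parallel>\<^sup>2 \<le> \<parallel>R\<parallel>\<^sup>2 = d - 1\<close>.
\<close>
lemma polar_factor_smallest_eigenvalue:
  fixes S :: "'n::finite \<Rightarrow> real^'p^'d" and X K :: "real^'p^'d" and H :: "real^'d^'d"
  assumes S: "\<And>i. S i ** transpose (S i) = mat 1" and X: "real CARD('n) *\<^sub>R X = (\<Sum>i\<in>UNIV. S i)"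
    and K: "K ** transpose K = mat 1" and XHK: "X = H ** K"
    and H: "transpose H = H" "\<And>y. 0 \<le> y \<bullet> (H *v y)"
  obtains \<sigma> where "0 \<le> \<sigma>" "\<And>y. \<sigma> * (norm y)\<^sup>2 \<le> y \<bullet> (H *v y)"
    "(norm X)\<^sup>2 - (real CARD('d) - 1) \<le> \<sigma>\<^sup>2"
proof -
  have ne: "(UNIV :: (real^'d) set) \<noteq> {0}"
    using norm_axis_1 by (metis UNIV_I norm_zero singletonD zero_neq_one)
  have sym: "x \<bullet> (H *v y) = y \<bullet> (H *v x)" for x y
    using H(1) symmetric_matrix_inner by (auto simp: symmetric_matrix_def)
  obtain e \<sigma> where e: "norm e = 1" "H *v e = \<sigma> *\<^sub>R e" and low: "\<And>y. \<sigma> * (norm y)\<^sup>2 \<le> y \<bullet> (H *v y)"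
    using minimal_eigenvector[OF matrix_vector_mul_linear subspace_UNIV ne _ sym] by (metis UNIV_I)
  have ee: "e \<bullet> e = 1" using e by (simp add: norm_eq_1)
  have "0 \<le> \<sigma>" using H(2)[of e] e ee by simp
  let ?E = "(\<chi> a b. e $ a * e $ b) :: real^'d^'d"
  let ?R = "mat 1 - ?E"
  have HE: "H \<bullet> ?E = \<sigma>" unfolding inner_outer_product using e ee by simp
  have EE: "?E \<bullet> ?E = 1" unfolding inner_outer_product outer_product_mult_vector using ee by simp
  have IE: "mat 1 \<bullet> ?E = 1" unfolding inner_outer_product using ee by simp
  have HmE: "H ** ?E = \<sigma> *\<^sub>R ?E"
  proof -
    have "(\<Sum>k\<in>UNIV. H $ i $ k * e $ k) = \<sigma> * e $ i" for i
      using e(2) by (simp add: vec_eq_iff matrix_vector_mult_def)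
    then show ?thesis
      by (simp add: vec_eq_iff matrix_matrix_mult_def mult.assoc[symmetric] sum_distrib_right[symmetric])
  qed
  have HK: "H = X ** transpose K" using K by (simp add: XHK matrix_mul_assoc[symmetric])
  have nX: "(norm X)\<^sup>2 = H \<bullet> H"
    unfolding XHK power2_norm_eq_inner inner_mult_right_adjoint by (simp add: matrix_mul_assoc[symmetric] K)
  have "H ** ?R = H - \<sigma> *\<^sub>R ?E" by (simp add: linear_diff[OF linear_mult_left] HmE)
  then have "(H ** ?R) \<bullet> (H ** ?R) = H \<bullet> H - \<sigma>\<^sup>2"
    by (simp add: inner_diff_left inner_diff_right HE EE inner_commute[of ?E H] power2_eq_square)
  moreover have "norm (H ** ?R) \<le> norm ?R"
  proof -
    have nR: "norm (transpose K ** ?R) = norm ?R"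
      unfolding norm_eq_sqrt_inner inner_mult_left_adjoint by (simp add: matrix_mul_assoc K)
    have sR: "real CARD('n) *\<^sub>R (H ** ?R) = (\<Sum>i\<in>UNIV. S i ** (transpose K ** ?R))"
    proof -
      have "real CARD('n) *\<^sub>R (H ** ?R) = (real CARD('n) *\<^sub>R X) ** (transpose K ** ?R)"
        unfolding HK linear_cmul[OF linear_mult_right] by (simp add: matrix_mul_assoc)
      then show ?thesis unfolding X linear_sum[OF linear_mult_right] .
    qed
    have "norm (\<Sum>i\<in>UNIV. S i ** (transpose K ** ?R)) \<le> real CARD('n) * norm (transpose K ** ?R)"
      by (rule sum_norm_bound) (rule norm_stiefel_mult_le[OF S])
    then have "norm (real CARD('n) *\<^sub>R (H ** ?R)) \<le> real CARD('n) * norm ?R"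
      unfolding sR nR .
    then show ?thesis by simp
  qed
  moreover have "?R \<bullet> ?R = real CARD('d) - 1"
    by (simp add: inner_diff_left inner_diff_right IE EE inner_commute[of ?E "mat 1"] inner_mat_1_mat_1)
  ultimately have "H \<bullet> H - \<sigma>\<^sup>2 \<le> real CARD('d) - 1"
    using power_mono[of "norm (H ** ?R)" "norm ?R" 2] by (simp add: power2_norm_eq_inner)
  then show ?thesis using that[OF \<open>0 \<le> \<sigma>\<close> low] nX by simp
qed

text \<open>
  Both \<open>I - N N\<^sup>T\<close> and \<open>I - N\<^sup>T N\<close> are Gram matrices, so their inner products with \<open>H\<close> are at
  least \<open>\<sigma>\<close> times their traces. The product \<open>N N\<close> is not symmetric, but its inner product with
  \<open>H\<close> is at most that of the average of \<open>N N\<^sup>T\<close> and \<open>N\<^sup>T N\<close>.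
\<close>
lemma polar_factor_trace_bound:
  fixes S K :: "real^'p^'d" and H :: "real^'d^'d"
  assumes S: "S ** transpose S = mat 1" and K: "K ** transpose K = mat 1"
    and H: "transpose H = H" "\<And>y. \<sigma> * (norm y)\<^sup>2 \<le> y \<bullet> (H *v y)" and \<sigma>: "0 \<le> \<sigma>"
    and \<tau>: "0 \<le> \<tau>" "\<tau> \<le> 1"
  defines "N \<equiv> K ** transpose S"
  shows "\<sigma> * (real CARD('d) - (norm N)\<^sup>2) \<le>
    H \<bullet> mat 1 - (1 - \<tau>) * (H \<bullet> (N ** transpose N)) - \<tau> * (H \<bullet> (N ** N))"
proof -
  let ?H = "H - \<sigma> *\<^sub>R mat 1"
  have psd: "0 \<le> y \<bullet> (?H *v y)" for y
    using H(2)[of y] by (simp add: matrix_vector_mult_diff_rdistrib inner_diff_right power2_norm_eq_inner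
        scaleR_matrix_vector_assoc[symmetric])
  have gram: "mat 1 - (A ** transpose B) ** transpose (A ** transpose B) =
     (A ** (mat 1 - row_proj B)) ** transpose (A ** (mat 1 - row_proj B))"
    if A: "A ** transpose A = mat 1" and B: "B ** transpose B = mat 1" for A B :: "real^'p^'d"
  proof -
    have "(A ** (mat 1 - row_proj B)) ** transpose (A ** (mat 1 - row_proj B)) =
      A ** ((mat 1 - row_proj B) ** (mat 1 - row_proj B)) ** transpose A"
      by (simp only: matrix_transpose_mul row_proj_projection(4)[OF B] matrix_mul_assoc)
    also have "\<dots> = mat 1 - (A ** transpose B) ** transpose (A ** transpose B)"
      unfolding row_proj_projection(2)[OF B]
      by (simp add: linear_diff[OF linear_mult_left] linear_diff[OF linear_mult_right] A
          matrix_transpose_mul matrix_mul_assoc)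
    finally show ?thesis by simp
  qed
  have tN: "transpose N = S ** transpose K" by (simp add: N_def matrix_transpose_mul)
  have "0 \<le> ?H \<bullet> (mat 1 - N ** transpose N)"
    unfolding N_def gram[OF K S] by (rule psd_inner_gram_nonneg[OF psd])
  moreover have "0 \<le> ?H \<bullet> (mat 1 - transpose N ** N)"
    using psd_inner_gram_nonneg[OF psd, of "S ** (mat 1 - row_proj K)"]
    unfolding gram[OF S K, symmetric] tN[symmetric] by simp
  moreover have "mat 1 \<bullet> (N ** transpose N) = (norm N)\<^sup>2" "mat 1 \<bullet> (transpose N ** N) = (norm N)\<^sup>2"
    using trace_mult_transpose[of N N] trace_transpose_mult[of N N]
    by (simp_all add: trace_eq_inner_mat inner_commute power2_norm_eq_inner)
  ultimately have 1: "\<sigma> * (real CARD('d) - (norm N)\<^sup>2) \<le> H \<bullet> mat 1 - H \<bullet> (N ** transpose N)"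
    "\<sigma> * (real CARD('d) - (norm N)\<^sup>2) \<le> H \<bullet> mat 1 - H \<bullet> (transpose N ** N)"
    by (simp_all add: inner_diff_left inner_diff_right inner_mat_1_mat_1 algebra_simps)
  have "2 * (H \<bullet> (N ** N)) \<le> H \<bullet> (N ** transpose N) + H \<bullet> (transpose N ** N)"
  proof (rule psd_inner_square_le[OF _ H(1)])
    fix y show "0 \<le> y \<bullet> (H *v y)" using H(2)[of y] \<sigma> by (meson order_trans mult_nonneg_nonneg zero_le_power2)
  qed
  then have 2: "\<sigma> * (real CARD('d) - (norm N)\<^sup>2) \<le> H \<bullet> mat 1 - H \<bullet> (N ** N)" using 1 by linarith
  have "(1 - \<tau>) * (\<sigma> * (real CARD('d) - (norm N)\<^sup>2)) + \<tau> * (\<sigma> * (real CARD('d) - (norm N)\<^sup>2))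
    \<le> (1 - \<tau>) * (H \<bullet> mat 1 - H \<bullet> (N ** transpose N)) + \<tau> * (H \<bullet> mat 1 - H \<bullet> (N ** N))"
    using 1(1) 2 \<tau> by (intro add_mono mult_left_mono) auto
  then show ?thesis by (simp add: algebra_simps)
qed

text \<open>
  Expand \<open>G K\<close> in the basis, then apply the Cauchy-Schwarz inequality once for the
  coefficients and once for the form of \<open>F\<close>. This converts the value of the form at the single
  direction \<open>G K\<close> into a bound on the sum over the basis.
\<close>
lemma Cauchy_Schwarz_over_Basis:
  fixes F :: "'b::real_inner \<Rightarrow> 'b" and G :: "'a::euclidean_space \<Rightarrow> 'b"
  assumes F: "linear F" "\<And>x y. x \<bullet> F y = y \<bullet> F x" "\<And>x. 0 \<le> x \<bullet> F x" and G: "linear G"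
  shows "(G K \<bullet> F S)\<^sup>2 \<le> (K \<bullet> K) * (S \<bullet> F S) * (\<Sum>\<Phi>\<in>Basis. G \<Phi> \<bullet> F (G \<Phi>))"
proof -
  have "G K = (\<Sum>\<Phi>\<in>Basis. (K \<bullet> \<Phi>) *\<^sub>R G \<Phi>)"
    using linear_sum[OF G, of "\<lambda>\<Phi>. (K \<bullet> \<Phi>) *\<^sub>R \<Phi>" Basis] linear_cmul[OF G] by (simp add: euclidean_representation)
  then have "(G K \<bullet> F S)\<^sup>2 = (\<Sum>\<Phi>\<in>Basis. (K \<bullet> \<Phi>) * (G \<Phi> \<bullet> F S))\<^sup>2" by (simp add: inner_sum_left)
  also have "\<dots> \<le> (\<Sum>\<Phi>\<in>Basis. (K \<bullet> \<Phi>)\<^sup>2) * (\<Sum>\<Phi>\<in>Basis. (G \<Phi> \<bullet> F S)\<^sup>2)"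
    by (rule Cauchy_Schwarz_ineq_sum)
  also have "\<dots> \<le> (\<Sum>\<Phi>\<in>Basis. (K \<bullet> \<Phi>)\<^sup>2) * (\<Sum>\<Phi>\<in>Basis. (G \<Phi> \<bullet> F (G \<Phi>)) * (S \<bullet> F S))"
    by (intro mult_left_mono sum_mono sum_nonneg Cauchy_Schwarz_semidefinite[OF F(1) subspace_UNIV])
      (use F in auto)
  also have "(\<Sum>\<Phi>\<in>Basis. (K \<bullet> \<Phi>)\<^sup>2) = K \<bullet> K"
    by (simp add: euclidean_inner[of K K] power2_eq_square)
  finally show ?thesis unfolding sum_distrib_right[symmetric] by (simp only: mult_ac)
qed

section \<open>The threshold\<close>

text \<open>
  \<open>T1\<close> is the summed Hessian inequality with slack \<open>T\<close>, and \<open>T2\<close> is the lower bound on the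
  slack. Dividing by \<open>\<Lambda> N d v\<close> turns them into \<open>r(\<tau>) lam/\<Lambda> \<le> G(1 - 1/\<alpha>, \<tau>)\<close>.
\<close>
lemma threshold_contradiction:
  fixes N \<Lambda> lam T u v w \<sigma> \<tau> \<alpha> :: real and p d :: nat
  assumes G: "G_fun p d (1 - inverse \<alpha>) \<tau> \<le> ereal (r_fun p d \<tau> * inverse \<alpha>)"
    and \<alpha>: "1 < \<alpha>" "\<Lambda> / lam < \<alpha>" and pos: "0 < lam" "0 < \<Lambda>" "0 < N" "0 < d" "d < p"
    and uvw: "0 \<le> u" "u \<le> w" "w \<le> v" "v \<le> 1" "0 < v"
    and \<sigma>: "1 - real d * v \<le> \<sigma>\<^sup>2"
    and T1: "T + r_fun p d \<tau> * (lam * (N * real d * v)) \<le> \<Lambda> * (N * real d *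
       (q_fun d \<tau> * (u * (2 - real p * u / (real p - real d)))
        + real d * \<tau>\<^sup>2 * (w * (2 - real p * real d * w / (real p * real d - 1)))))"
    and T2: "(\<Lambda> * \<sigma> * (N * real d * u))\<^sup>2 \<le> real d * ((\<Lambda> - lam) * (N * real d * v)) * T"
    and T: "0 \<le> T"
  shows False
proof -
  define x where "x = 1 - inverse \<alpha>"
  have x: "0 < x" using \<alpha>(1) by (simp add: x_def inverse_less_1_iff)
  have ratio: "inverse \<alpha> < lam / \<Lambda>" using \<alpha> pos by (simp add: field_simps)
  have "0 \<le> 2 * (real d - 1) * \<tau>\<^sup>2" using pos by (intro mult_nonneg_nonneg) auto
  then have r: "0 < r_fun p d \<tau>" unfolding r_fun_def using pos by linarith
  define B where "B = q_fun d \<tau> * (u * (2 - real p * u / (real p - real d)))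
        + real d * \<tau>\<^sup>2 * (w * (2 - real p * real d * w / (real p * real d - 1)))"
  have "\<Lambda> - lam \<le> \<Lambda> * x" using ratio pos by (simp add: x_def field_simps)
  have "(\<Lambda> * \<sigma> * (N * real d * u))\<^sup>2 \<le> real d * ((\<Lambda> * x) * (N * real d * v)) * T"
  proof (rule order_trans[OF T2])
    show "real d * ((\<Lambda> - lam) * (N * real d * v)) * T \<le> real d * ((\<Lambda> * x) * (N * real d * v)) * T"
      using \<open>\<Lambda> - lam \<le> \<Lambda> * x\<close> pos uvw T
      by (intro mult_right_mono mult_left_mono) auto
  qed
  then have "(\<Lambda> * N * (real d)\<^sup>2) * (\<Lambda> * N * \<sigma>\<^sup>2 * u\<^sup>2) \<le> (\<Lambda> * N * (real d)\<^sup>2) * (x * v * T)"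
    by (simp add: power2_eq_square mult_ac)
  then have "\<Lambda> * N * \<sigma>\<^sup>2 * u\<^sup>2 \<le> x * v * T"
    using pos by (subst (asm) mult_le_cancel_left_pos) auto
  then have Tl: "\<Lambda> * N * \<sigma>\<^sup>2 * u\<^sup>2 / (x * v) \<le> T"
    using x uvw by (simp add: pos_divide_le_eq mult_ac)
  have "max (1 - real d * v) 0 \<le> \<sigma>\<^sup>2" using \<sigma> by simp
  then have "\<Lambda> * N * max (1 - real d * v) 0 * u\<^sup>2 / (x * v) \<le> \<Lambda> * N * \<sigma>\<^sup>2 * u\<^sup>2 / (x * v)"
    using pos x uvw by (intro divide_right_mono mult_right_mono mult_left_mono) auto
  with Tl T1 have "\<Lambda> * N * max (1 - real d * v) 0 * u\<^sup>2 / (x * v) + r_fun p d \<tau> * (lam * (N * real d * v))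
     \<le> \<Lambda> * (N * real d * B)" unfolding B_def by linarith
  then have "(\<Lambda> * N * max (1 - real d * v) 0 * u\<^sup>2 / (x * v) + r_fun p d \<tau> * (lam * (N * real d * v))) / (\<Lambda> * N * real d * v)
     \<le> \<Lambda> * (N * real d * B) / (\<Lambda> * N * real d * v)"
    using pos uvw by (intro divide_right_mono) auto
  also have "\<Lambda> * (N * real d * B) / (\<Lambda> * N * real d * v) = B / v" using pos uvw by (simp add: field_simps)
  also have "(\<Lambda> * N * max (1 - real d * v) 0 * u\<^sup>2 / (x * v) + r_fun p d \<tau> * (lam * (N * real d * v))) / (\<Lambda> * N * real d * v)
      = (1 / x) * (max (1 - real d * v) 0 * u\<^sup>2 / (real d * v\<^sup>2)) + r_fun p d \<tau> * (lam / \<Lambda>)"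
    using pos uvw x by (simp add: add_divide_distrib power2_eq_square)
  finally have "r_fun p d \<tau> * (lam / \<Lambda>) \<le> B / v - (1 / x) * (max (1 - real d * v) 0 * u\<^sup>2 / (real d * v\<^sup>2))"
    by linarith
  also have "B / v = q_fun d \<tau> * (u / v) * (2 - real p * u / (real p - real d))
               + real d * \<tau>\<^sup>2 * (w / v) * (2 - real p * real d * w / (real p * real d - 1))"
    unfolding B_def by (simp add: add_divide_distrib)
  finally have "ereal (r_fun p d \<tau> * (lam / \<Lambda>)) \<le> ereal (q_fun d \<tau> * (u / v) * (2 - real p * u / (real p - real d))
               + real d * \<tau>\<^sup>2 * (w / v) * (2 - real p * real d * w / (real p * real d - 1))
               - (1 / x) * (max (1 - real d * v) 0 * u\<^sup>2 / (real d * v\<^sup>2)))" by simp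
  also have "\<dots> \<le> G_fun p d x \<tau>"
    unfolding G_fun_def using uvw by (intro Sup_upper) blast
  also have "\<dots> \<le> ereal (r_fun p d \<tau> * inverse \<alpha>)" unfolding x_def by (rule G)
  finally have "r_fun p d \<tau> * (lam / \<Lambda>) \<le> r_fun p d \<tau> * inverse \<alpha>" by simp
  then show False using mult_strict_left_mono[OF ratio r] by linarith
qed

section \<open>Families of blocks and their means\<close>

definition constant_family :: "real^'p^'d \<Rightarrow> real^'p^'d^'n" where
  "constant_family \<Phi> = (\<chi> i. \<Phi>)"

definition block_mean :: "real^'p^'d^'n \<Rightarrow> real^'p^'d" where
  "block_mean U = (1 / real CARD('n)) *\<^sub>R (\<Sum>i\<in>UNIV. U $ i)"

definition centered :: "real^'p^'d^'n \<Rightarrow> real^'p^'d^'n" where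
  "centered U = U - constant_family (block_mean U)"

lemma linear_constant_family: "linear (constant_family :: real^'p^'d \<Rightarrow> real^'p^'d^'n)"
  by (rule linearI) (simp_all add: constant_family_def vec_eq_iff)

lemma linear_block_mean: "linear (block_mean :: real^'p^'d^'n \<Rightarrow> _)"
  by (rule linearI) (simp_all add: block_mean_def sum.distrib scaleR_sum_right scaleR_add_right)

lemma linear_centered: "linear centered"
  by (rule linearI) (simp_all add: centered_def linear_add[OF linear_constant_family]
    linear_add[OF linear_block_mean] linear_cmul[OF linear_constant_family] linear_cmul[OF linear_block_mean]
    scaleR_diff_right)

lemma sum_block_mean: "(\<Sum>i\<in>UNIV. U $ i) = real CARD('n) *\<^sub>R block_mean U" for U :: "real^'p^'d^'n"
  by (simp add: block_mean_def)

lemma inner_constant_family: "U \<bullet> constant_family \<Phi> = real CARD('n) * (block_mean U \<bullet> \<Phi>)"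
  for U :: "real^'p^'d^'n"
proof -
  have "U \<bullet> constant_family \<Phi> = (\<Sum>i\<in>UNIV. U $ i) \<bullet> \<Phi>"
    by (simp add: inner_vec_def[of U] constant_family_def inner_sum_left)
  then show ?thesis by (simp add: sum_block_mean)
qed

lemma inner_centered: "U \<bullet> centered W = U \<bullet> W - real CARD('n) * (block_mean U \<bullet> block_mean W)"
  for U W :: "real^'p^'d^'n"
  by (simp add: centered_def inner_diff_right inner_constant_family)

lemma block_mean_centered: "block_mean (centered U) = 0" for U :: "real^'p^'d^'n"
proof -
  have "block_mean (constant_family \<Phi> :: real^'p^'d^'n) = \<Phi>" for \<Phi>
    by (simp add: block_mean_def constant_family_def sum_constant_scaleR del: sum_constant)
  then show ?thesis by (simp add: centered_def linear_diff[OF linear_block_mean])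
qed

lemma inner_centered_centered: "centered U \<bullet> centered U = U \<bullet> centered U" for U :: "real^'p^'d^'n"
  by (simp add: inner_centered[of "centered U"] block_mean_centered inner_commute)

text \<open>
  The deviation of the test directions from their mean, summed over all \<open>\<Phi>\<close>; it is what
  remains of the upper bound on \<open>\<langle>V, L V\<rangle>\<close>.
\<close>
lemma sum_Basis_centered_directions:
  fixes S :: "real^'p^'d^'n" and \<tau> :: real
  assumes S: "\<And>i. S $ i ** transpose (S $ i) = mat 1"
  defines "G \<equiv> \<lambda>\<Phi>. (\<chi> i. direction_offset \<tau> (S $ i) \<Phi>) :: real^'p^'d^'n"
  shows "(\<Sum>\<Phi>\<in>Basis. G \<Phi> \<bullet> centered (G \<Phi>)) =
     real CARD('n) * (q_fun CARD('d) \<tau> * real CARD('d) + \<tau>\<^sup>2 * (real CARD('d))\<^sup>2)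
     - (q_fun CARD('d) \<tau> * (\<Sum>i\<in>UNIV. \<Sum>j\<in>UNIV. row_proj (S $ i) \<bullet> row_proj (S $ j))
        + \<tau>\<^sup>2 * (\<Sum>i\<in>UNIV. \<Sum>j\<in>UNIV. (S $ i \<bullet> S $ j)\<^sup>2)) / real CARD('n)"
proof -
  let ?n = "real CARD('n)"
  let ?D = "\<lambda>i j. \<Sum>\<Phi>\<in>Basis. direction_offset \<tau> (S $ i) \<Phi> \<bullet> direction_offset \<tau> (S $ j) \<Phi>"
  have "G \<Phi> \<bullet> centered (G \<Phi>) = (\<Sum>i\<in>UNIV. direction_offset \<tau> (S $ i) \<Phi> \<bullet> direction_offset \<tau> (S $ i) \<Phi>)
      - (\<Sum>i\<in>UNIV. \<Sum>j\<in>UNIV. direction_offset \<tau> (S $ i) \<Phi> \<bullet> direction_offset \<tau> (S $ j) \<Phi>) / ?n" for \<Phi>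
  proof -
    have "?n * (block_mean (G \<Phi>) \<bullet> block_mean (G \<Phi>)) =
       ((\<Sum>i\<in>UNIV. G \<Phi> $ i) \<bullet> (\<Sum>j\<in>UNIV. G \<Phi> $ j)) / ?n"
      by (simp add: sum_block_mean)
    also have "(\<Sum>i\<in>UNIV. G \<Phi> $ i) \<bullet> (\<Sum>j\<in>UNIV. G \<Phi> $ j) = (\<Sum>i\<in>UNIV. \<Sum>j\<in>UNIV. G \<Phi> $ i \<bullet> G \<Phi> $ j)"
      by (simp only: inner_sum_left inner_sum_right) (rule sum.swap)
    finally show ?thesis
      unfolding inner_centered inner_vec_def[of "G \<Phi>" "G \<Phi>"] by (simp add: G_def)
  qed
  then have "(\<Sum>\<Phi>\<in>Basis. G \<Phi> \<bullet> centered (G \<Phi>)) =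
     (\<Sum>\<Phi>\<in>Basis. \<Sum>i\<in>UNIV. direction_offset \<tau> (S $ i) \<Phi> \<bullet> direction_offset \<tau> (S $ i) \<Phi>)
     - (\<Sum>\<Phi>\<in>Basis. \<Sum>i\<in>UNIV. \<Sum>j\<in>UNIV. direction_offset \<tau> (S $ i) \<Phi> \<bullet> direction_offset \<tau> (S $ j) \<Phi>) / ?n"
    by (simp add: sum_subtractf sum_divide_distrib)
  also have "(\<Sum>\<Phi>\<in>Basis. \<Sum>i\<in>UNIV. direction_offset \<tau> (S $ i) \<Phi> \<bullet> direction_offset \<tau> (S $ i) \<Phi>) = (\<Sum>i\<in>UNIV. ?D i i)"
    by (rule sum.swap)
  also have "(\<Sum>\<Phi>\<in>Basis. \<Sum>i\<in>UNIV. \<Sum>j\<in>UNIV. direction_offset \<tau> (S $ i) \<Phi> \<bullet> direction_offset \<tau> (S $ j) \<Phi>)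
      = (\<Sum>i\<in>UNIV. \<Sum>j\<in>UNIV. ?D i j)"
    by (subst sum.swap) (intro sum.cong refl sum.swap)
  finally show ?thesis
    unfolding sum_Basis_direction_offset_inner
    by (simp add: inner_row_proj S inner_mat_1_mat_1 inner_stiefel_self[OF S] sum.distrib sum_distrib_left)
qed

text \<open>
  For a family with \<open>L S = C S\<close> these are the values needed to evaluate the form of \<open>L\<close> at the
  pair of the direction for \<open>\<Phi> = K\<close> and \<open>S\<close>. The first one is linear in \<open>C S\<close>, so it
  disappears on summation over the blocks, where \<open>\<Sum> C\<^sub>i S\<^sub>i = 0\<close>.
\<close>
lemma direction_offset_inner_first_order:
  fixes S K :: "real^'p^'d" and C H :: "real^'d^'d" and \<tau> :: real
  assumes S: "S ** transpose S = mat 1" and C: "transpose C = C" and H: "transpose H = H"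
  defines "N \<equiv> K ** transpose S"
  shows "direction_offset \<tau> S K \<bullet> (C ** S) = - (K \<bullet> (C ** S))"
    and "direction_offset \<tau> S K \<bullet> (H ** K) = - (1 - \<tau>) * (H \<bullet> (N ** transpose N)) - \<tau> * (H \<bullet> (N ** N))"
proof -
  have P: "(K ** row_proj S) \<bullet> Y = N \<bullet> (Y ** transpose S)" for Y
    by (simp add: N_def matrix_mul_assoc inner_mult_right_adjoint[of "K ** transpose S" S])
  have Q: "(S ** transpose K ** S) \<bullet> Y = transpose N \<bullet> (Y ** transpose S)" for Y
    by (simp add: N_def inner_mult_right_adjoint[of "S ** transpose K" S] matrix_transpose_mul)
  have CSS: "C ** S ** transpose S = C" by (simp add: matrix_mul_assoc[symmetric] S)
  have KC: "K \<bullet> (C ** S) = N \<bullet> C"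
    unfolding N_def by (simp add: inner_mult_right_adjoint)
  have tNC: "transpose N \<bullet> C = N \<bullet> C"
    using inner_transpose_transpose[of N C] by (simp add: C)
  show "direction_offset \<tau> S K \<bullet> (C ** S) = - (K \<bullet> (C ** S))"
    unfolding direction_offset_def inner_diff_left inner_scaleR_left P Q CSS tNC KC by (simp add: algebra_simps)
  have HKS: "H ** K ** transpose S = H ** N" by (simp add: N_def matrix_mul_assoc)
  have "N \<bullet> (H ** N) = H \<bullet> (N ** transpose N)"
    using inner_mult_right_adjoint[of H N N] by (simp add: inner_commute)
  moreover have "transpose N \<bullet> (H ** N) = H \<bullet> (N ** N)"
  proof -
    have "transpose N \<bullet> (H ** N) = H \<bullet> (transpose N ** transpose N)"
      using inner_mult_right_adjoint[of H N "transpose N"] by (simp add: inner_commute)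
    then show ?thesis using inner_transpose_transpose[of H "N ** N"] by (simp add: H matrix_transpose_mul)
  qed
  ultimately show "direction_offset \<tau> S K \<bullet> (H ** K) = - (1 - \<tau>) * (H \<bullet> (N ** transpose N)) - \<tau> * (H \<bullet> (N ** N))"
    unfolding direction_offset_def inner_diff_left inner_scaleR_left P Q HKS by simp
qed

lemma q_fun_nonneg: "0 \<le> \<tau> \<Longrightarrow> \<tau> \<le> 1 \<Longrightarrow> 0 \<le> q_fun d \<tau>"
proof -
  assume "0 \<le> \<tau>" "\<tau> \<le> 1"
  moreover have "q_fun d \<tau> = real d * (1 - \<tau>)\<^sup>2 + 2 * \<tau> * (1 - \<tau>)"
    by (simp add: q_fun_def power2_eq_square algebra_simps)
  ultimately show ?thesis by simp
qed

lemma alpha_G_witness: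
  assumes "ereal x < alpha_G p d"
  obtains \<tau> \<alpha> where "0 \<le> \<tau>" "\<tau> \<le> 1" "1 < \<alpha>" "x < \<alpha>"
    "G_fun p d (1 - inverse \<alpha>) \<tau> \<le> ereal (r_fun p d \<tau> * inverse \<alpha>)"
proof -
  obtain \<tau> where \<tau>: "\<tau> \<in> {0..1}" "ereal x < alpha_G_at p d \<tau>"
    using assms unfolding alpha_G_def less_SUP_iff by blast
  from \<tau>(2) obtain \<alpha> where "1 < \<alpha>" "G_fun p d (1 - inverse \<alpha>) \<tau> \<le> ereal (r_fun p d \<tau> * inverse \<alpha>)"
    "ereal x < ereal \<alpha>"
    unfolding alpha_G_at_def less_Sup_iff by blast
  with \<tau>(1) that[of \<tau> \<alpha>] show ?thesis by simp
qed

text \<open>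
  The unit vector on the line of \<open>X\<close>, factored through \<open>K\<close>. If \<open>X = 0\<close>, any unit multiple of
  \<open>K\<close> serves; the factorisation is what makes \<open>u \<le> w\<close>.
\<close>
lemma unit_multiple_of_polar_factor:
  fixes X K :: "real^'p^'d" and H :: "real^'d^'d"
  assumes K: "K ** transpose K = mat 1" and X: "X = H ** K"
  obtains G where "norm G = 1" "norm (G ** K) = 1" "X \<bullet> (G ** K) = norm X"
proof -
  have nGK: "norm (G ** K) = norm G" for G :: "real^'d^'d"
    unfolding norm_eq_sqrt_inner by (simp add: inner_mult_right_adjoint matrix_mul_assoc[symmetric] K)
  show ?thesis
  proof (cases "X = 0")
    case True
    define G where "G = (1 / norm (mat 1 :: real^'d^'d)) *\<^sub>R (mat 1 :: real^'d^'d)"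
    have "norm (mat 1 :: real^'d^'d) \<noteq> 0" by (simp add: norm_eq_sqrt_inner inner_mat_1_mat_1)
    then have "norm G = 1" by (simp add: G_def)
    with that nGK True show ?thesis by simp
  next
    case False
    define G where "G = (1 / norm X) *\<^sub>R H"
    have GK: "G ** K = (1 / norm X) *\<^sub>R X" by (simp add: G_def X linear_cmul[OF linear_mult_right])
    have "norm (G ** K) = 1" using False by (simp add: GK)
    moreover have "X \<bullet> (G ** K) = norm X"
      using False by (simp add: GK dot_square_norm power2_eq_square)
    ultimately show ?thesis using that nGK by metis
  qed
qed

section \<open>Critical families have equal blocks\<close>

text \<open>
  The main estimate. The operator \<open>L\<close> acts on families of \<open>d \<times> p\<close> blocks and \<open>C\<close> is the family
  of multipliers; the proof derives the two inequalities of \<open>threshold_contradiction\<close> from a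
  family whose blocks are not all equal.
\<close>
lemma critical_family_constant:
  fixes S :: "real^'p^'d^'n" and L :: "real^'p^'d^'n \<Rightarrow> real^'p^'d^'n" and C :: "'n \<Rightarrow> real^'d^'d"
  assumes pd: "CARD('d) < CARD('p)"
    and S: "\<And>i. S $ i ** transpose (S $ i) = mat 1"
    and L: "linear L" "\<And>U W. U \<bullet> L W = W \<bullet> L U" "\<And>\<Phi>. L (constant_family \<Phi>) = 0"
    and lower: "\<And>U. block_mean U = 0 \<Longrightarrow> lam * (U \<bullet> U) \<le> U \<bullet> L U"
    and upper: "\<And>U. U \<bullet> L U \<le> \<Lambda> * (U \<bullet> U)"
    and lam: "0 < lam" and ratio: "ereal (\<Lambda> / lam) < alpha_G CARD('p) CARD('d)"
    and C: "\<And>i. transpose (C i) = C i"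
    and first: "\<And>i. L S $ i = C i ** S $ i"
    and second: "\<And>V. (\<And>i. V $ i ** transpose (S $ i) + S $ i ** transpose (V $ i) = 0) \<Longrightarrow>
      (\<Sum>i\<in>UNIV. V $ i \<bullet> (C i ** V $ i)) \<le> V \<bullet> L V"
  shows "S = constant_family (block_mean S)"
proof (rule ccontr)
  let ?n = "real CARD('n)" and ?d = "real CARD('d)" and ?p = "real CARD('p)"
  have npos: "0 < ?n" "0 < ?d" "?d < ?p" using pd by auto
  assume "S \<noteq> constant_family (block_mean S)"
  then have "centered S \<noteq> 0" by (simp add: centered_def)
  define X where "X = block_mean S"
  define v where "v = 1 - (norm X)\<^sup>2 / ?d"
  have Si: "S $ i \<bullet> S $ i = ?d" for i by (rule inner_stiefel_self[OF S])
  have SS: "S \<bullet> S = ?n * ?d" by (simp add: inner_vec_def[of S] Si)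
  have ScS: "S \<bullet> centered S = ?n * ?d * v"
    unfolding inner_centered SS v_def X_def using npos by (simp add: field_simps power2_norm_eq_inner)
  have "0 < S \<bullet> centered S"
    using \<open>centered S \<noteq> 0\<close> inner_centered_centered[of S] by (metis inner_gt_zero_iff)
  then have "0 < (?n * ?d) * v" unfolding ScS .
  then have v: "0 < v" "v \<le> 1"
    using npos zero_less_mult_pos[of "?n * ?d" v] by (auto simp: v_def)
  have Lc: "U \<bullet> L U = centered U \<bullet> L (centered U)" for U
    using L(2)[of "constant_family _"]
    by (simp add: centered_def linear_diff[OF L(1)] L(3) inner_diff_left)
  \<comment> \<open>Since \<open>L\<close> ignores the mean, its bounds on centered families hold for every family.\<close>
  have lowc: "lam * (U \<bullet> centered U) \<le> U \<bullet> L U" for U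
    using lower[OF block_mean_centered[of U]] unfolding Lc[symmetric] inner_centered_centered .
  have uppc: "U \<bullet> L U \<le> \<Lambda> * (U \<bullet> centered U)" for U
    using upper[of "centered U"] unfolding Lc[symmetric] inner_centered_centered .
  have \<Lambda>: "0 < \<Lambda>"
  proof -
    have "lam * (S \<bullet> centered S) \<le> \<Lambda> * (S \<bullet> centered S)" using lowc[of S] uppc[of S] by linarith
    then have "lam \<le> \<Lambda>" using \<open>0 < S \<bullet> centered S\<close> by simp
    then show ?thesis using lam by simp
  qed
  obtain \<tau> \<alpha> where \<tau>: "0 \<le> \<tau>" "\<tau> \<le> 1" and \<alpha>: "1 < \<alpha>" "\<Lambda> / lam < \<alpha>"
    "G_fun CARD('p) CARD('d) (1 - inverse \<alpha>) \<tau> \<le> ereal (r_fun CARD('p) CARD('d) \<tau> * inverse \<alpha>)"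
    using alpha_G_witness[OF ratio] by blast

  obtain K H where K: "K ** transpose K = mat 1" and XHK: "X = H ** K" and H: "transpose H = H"
    "\<And>y. 0 \<le> y \<bullet> (H *v y)"
    using polar_decomposition[of X] pd by auto
  have nX: "?n *\<^sub>R X = (\<Sum>i\<in>UNIV. S $ i)" by (simp add: X_def sum_block_mean)
  obtain \<sigma> where \<sigma>: "0 \<le> \<sigma>" "\<And>y. \<sigma> * (norm y)\<^sup>2 \<le> y \<bullet> (H *v y)" "(norm X)\<^sup>2 - (?d - 1) \<le> \<sigma>\<^sup>2"
    using polar_factor_smallest_eigenvalue[OF S nX K XHK H] by blast
  obtain Q where Q: "norm Q = 1" "norm (Q ** K) = 1" "X \<bullet> (Q ** K) = norm X"
    using unit_multiple_of_polar_factor[OF K XHK] by blast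

  define N where "N i = K ** transpose (S $ i)" for i
  define a where "a = (\<Sum>i\<in>UNIV. (norm (N i))\<^sup>2)"
  define b where "b = (\<Sum>i\<in>UNIV. (S $ i \<bullet> (Q ** K))\<^sup>2)"
  define u where "u = 1 - a / (?n * ?d)"
  define w where "w = 1 - b / (?n * ?d)"
  have "a \<le> ?n * ?d"
  proof -
    have "(norm (N i))\<^sup>2 \<le> ?d" for i
    proof -
      have "norm (N i) = norm (S $ i ** transpose K)"
        using inner_transpose_transpose[of "N i" "N i"] by (simp add: N_def matrix_transpose_mul norm_eq_sqrt_inner)
      also have "\<dots> \<le> norm (transpose K)" by (rule norm_stiefel_mult_le[OF S])
      also have "\<dots> = sqrt ?d"
        using norm_stiefel[OF K] inner_transpose_transpose[of K K] by (simp add: norm_eq_sqrt_inner)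
      finally show ?thesis using power_mono[of "norm (N i)" "sqrt ?d" 2] by simp
    qed
    then show ?thesis unfolding a_def using sum_bounded_above[of UNIV "\<lambda>i. (norm (N i))\<^sup>2" ?d] by simp
  qed
  have "b \<le> a"
  proof -
    have "(S $ i \<bullet> (Q ** K))\<^sup>2 \<le> (norm (N i))\<^sup>2" for i
    proof -
      have "S $ i \<bullet> (Q ** K) = Q \<bullet> transpose (N i)"
        using inner_mult_right_adjoint[of Q K "S $ i"] by (simp add: N_def matrix_transpose_mul inner_commute)
      moreover have "\<bar>Q \<bullet> transpose (N i)\<bar> \<le> norm Q * norm (transpose (N i))" by (rule Cauchy_Schwarz_ineq2)
      ultimately have "\<bar>S $ i \<bullet> (Q ** K)\<bar> \<le> norm (N i)"
        using Q(1) inner_transpose_transpose[of "N i" "N i"] by (simp add: norm_eq_sqrt_inner)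
      then show ?thesis using power_mono[of "\<bar>S $ i \<bullet> (Q ** K)\<bar>" "norm (N i)" 2] by simp
    qed
    then show ?thesis unfolding a_def b_def by (rule sum_mono)
  qed
  have "?n * (norm X)\<^sup>2 \<le> b"
  proof -
    have "(\<Sum>i\<in>UNIV. S $ i \<bullet> (Q ** K)) = ?n * norm X"
      using Q(3) by (simp add: inner_sum_left[symmetric] nX[symmetric])
    then have "(?n * norm X)\<^sup>2 \<le> ?n * b"
      using Cauchy_Schwarz_ineq_sum[of "\<lambda>i. 1" "\<lambda>i. S $ i \<bullet> (Q ** K)" UNIV] by (simp add: b_def)
    then have "?n * (?n * (norm X)\<^sup>2) \<le> ?n * b" by (simp add: power2_eq_square mult_ac)
    then show ?thesis using npos by simp
  qed
  have uwv: "0 \<le> u" "u \<le> w" "w \<le> v"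
  proof -
    show "0 \<le> u" using \<open>a \<le> ?n * ?d\<close> npos by (simp add: u_def field_simps)
    show "u \<le> w" using \<open>b \<le> a\<close> npos by (simp add: u_def w_def divide_right_mono)
    have "(norm X)\<^sup>2 / ?d = (?n * (norm X)\<^sup>2) / (?n * ?d)" using npos by simp
    also have "\<dots> \<le> b / (?n * ?d)" using \<open>?n * (norm X)\<^sup>2 \<le> b\<close> npos by (intro divide_right_mono) auto
    finally show "w \<le> v" by (simp add: w_def v_def)
  qed
  have ab: "a = ?n * ?d * (1 - u)" "b = ?n * ?d * (1 - w)" using npos by (auto simp: u_def w_def)

  \<comment> \<open>The semidefinite form that is lost when \<open>L\<close> is bounded above by \<open>\<Lambda>\<close>; \<open>T\<close> is its total value on the test directions.\<close>
  define F where "F W = \<Lambda> *\<^sub>R centered W - L W" for W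
  define G where "G \<Phi> = (\<chi> i. direction_offset \<tau> (S $ i) \<Phi>)" for \<Phi>
  define T where "T = (\<Sum>\<Phi>\<in>Basis. G \<Phi> \<bullet> F (G \<Phi>))"
  have linF: "linear F"
    unfolding F_def by (intro linear_compose_sub linear_compose_scale_right linear_centered L(1))
  have linG: "linear G"
    by (rule linearI) (simp_all add: G_def vec_eq_iff linear_add[OF linear_direction_offset] linear_cmul[OF linear_direction_offset])
  have symF: "x \<bullet> F y = y \<bullet> F x" for x y
    using L(2)[of x y] by (simp add: F_def inner_diff_right inner_centered inner_commute)
  have psdF: "0 \<le> x \<bullet> F x" for x
    using uppc[of x] by (simp add: F_def inner_diff_right)
  have "0 \<le> T" unfolding T_def by (intro sum_nonneg psdF)

  have trC: "S \<bullet> L S = (\<Sum>i\<in>UNIV. trace (C i))"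
  proof -
    have "S $ i \<bullet> (C i ** S $ i) = trace (C i)" for i
      using inner_mult_right_adjoint[of "C i" "S $ i" "S $ i"] by (simp add: S trace_eq_inner_mat inner_commute)
    then show ?thesis by (simp add: inner_vec_def[of S] first)
  qed
  have q: "0 \<le> q_fun CARD('d) \<tau>" by (rule q_fun_nonneg[OF \<tau>])
  have r: "0 \<le> r_fun CARD('p) CARD('d) \<tau>"
  proof -
    have "1 \<le> ?d" using npos by (simp add: Suc_leI)
    then have "0 \<le> 2 * (?d - 1) * \<tau>\<^sup>2" by (intro mult_nonneg_nonneg) auto
    then show ?thesis unfolding r_fun_def using npos by linarith
  qed
  have curvature: "r_fun CARD('p) CARD('d) \<tau> * (lam * (?n * ?d * v)) \<le> (\<Sum>\<Phi>\<in>Basis. G \<Phi> \<bullet> L (G \<Phi>))"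
  proof -
    have "r_fun CARD('p) CARD('d) \<tau> * (lam * (?n * ?d * v)) \<le> r_fun CARD('p) CARD('d) \<tau> * (S \<bullet> L S)"
      using lowc[of S] r unfolding ScS by (rule mult_left_mono)
    also have "\<dots> = (\<Sum>i\<in>UNIV. \<Sum>\<Phi>\<in>Basis. direction \<tau> (S $ i) \<Phi> \<bullet> (C i ** direction \<tau> (S $ i) \<Phi>))"
      unfolding trC by (simp add: sum_Basis_direction_quadratic[OF S C] sum_distrib_left)
    also have "\<dots> = (\<Sum>\<Phi>\<in>Basis. \<Sum>i\<in>UNIV. direction \<tau> (S $ i) \<Phi> \<bullet> (C i ** direction \<tau> (S $ i) \<Phi>))"
      by (rule sum.swap)
    also have "\<dots> \<le> (\<Sum>\<Phi>\<in>Basis. G \<Phi> \<bullet> L (G \<Phi>))"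
    proof (rule sum_mono)
      fix \<Phi> :: "real^'p^'d"
      define V :: "real^'p^'d^'n" where "V = (\<chi> i. direction \<tau> (S $ i) \<Phi>)"
      have "V = constant_family \<Phi> + G \<Phi>"
        by (simp add: V_def constant_family_def G_def direction_def vec_eq_iff)
      then have "V \<bullet> L V = G \<Phi> \<bullet> L (G \<Phi>)"
        using L(2)[of "constant_family \<Phi>" "G \<Phi>"] by (simp add: linear_add[OF L(1)] L(3) inner_add_left)
      moreover have "(\<Sum>i\<in>UNIV. V $ i \<bullet> (C i ** V $ i)) \<le> V \<bullet> L V"
        by (rule second) (simp add: V_def direction_tangent[OF S])
      ultimately show "(\<Sum>i\<in>UNIV. direction \<tau> (S $ i) \<Phi> \<bullet> (C i ** direction \<tau> (S $ i) \<Phi>)) \<le> G \<Phi> \<bullet> L (G \<Phi>)"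
        by (simp add: V_def)
    qed
    finally show ?thesis .
  qed
  define PP where "PP = (\<Sum>i\<in>UNIV. \<Sum>j\<in>UNIV. row_proj (S $ i) \<bullet> row_proj (S $ j))"
  define DD where "DD = (\<Sum>i\<in>UNIV. \<Sum>j\<in>UNIV. (S $ i \<bullet> S $ j)\<^sup>2)"
  have PP: "?n * ?d - PP / ?n \<le> ?n * ?d * (u * (2 - ?p * u / (?p - ?d)))"
  proof -
    have "a\<^sup>2 / ?d + (?n * ?d - a)\<^sup>2 / (?p - ?d) \<le> PP"
      unfolding a_def N_def PP_def by (rule sum_row_proj_inner_ge[OF S K pd])
    also have "a\<^sup>2 / ?d + (?n * ?d - a)\<^sup>2 / (?p - ?d) = ?n * (?n * ?d * ((1 - u)\<^sup>2 + ?d * u\<^sup>2 / (?p - ?d)))"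
      unfolding ab using npos by (simp add: power2_eq_square field_simps)
    finally have "?n * ?d * ((1 - u)\<^sup>2 + ?d * u\<^sup>2 / (?p - ?d)) \<le> PP / ?n"
      using npos by (simp add: pos_le_divide_eq mult_ac)
    moreover have "?n * ?d * ((1 - u)\<^sup>2 + ?d * u\<^sup>2 / (?p - ?d)) = ?n * ?d - ?n * ?d * (u * (2 - ?p * u / (?p - ?d)))"
      using npos by (simp add: power2_eq_square field_simps)
    ultimately show ?thesis by linarith
  qed
  have dp: "1 < CARD('d) * CARD('p)"
  proof -
    have "1 \<le> CARD('d)" by (simp add: Suc_leI)
    then show ?thesis using pd by (metis One_nat_def Suc_leI le_less_trans less_le_trans mult_le_mono1 nat_mult_1)
  qed
  then have dp': "1 < ?p * ?d" by (metis mult.commute of_nat_1 of_nat_less_iff of_nat_mult)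
  have DD: "?n * ?d\<^sup>2 - DD / ?n \<le> ?n * ?d\<^sup>2 * (w * (2 - ?p * ?d * w / (?p * ?d - 1)))"
  proof -
    have "b\<^sup>2 + (?n * ?d - b)\<^sup>2 / (?d * ?p - 1) \<le> DD"
      using sum_inner_squares_ge_matrix[OF Q(2) dp, of "\<lambda>i. S $ i"] by (simp add: b_def DD_def Si)
    also have "b\<^sup>2 + (?n * ?d - b)\<^sup>2 / (?d * ?p - 1) = ?n * (?n * ?d\<^sup>2 * ((1 - w)\<^sup>2 + w\<^sup>2 / (?p * ?d - 1)))"
      unfolding ab mult.commute[of ?d ?p] by (simp add: power2_eq_square field_simps)
    finally have "?n * ?d\<^sup>2 * ((1 - w)\<^sup>2 + w\<^sup>2 / (?p * ?d - 1)) \<le> DD / ?n"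
      using npos by (simp add: pos_le_divide_eq mult_ac)
    moreover have "(1 - w)\<^sup>2 + w\<^sup>2 / (?p * ?d - 1) = 1 - w * (2 - ?p * ?d * w / (?p * ?d - 1))"
      using dp' by (simp add: power2_eq_square field_simps)
    ultimately show ?thesis by (simp add: right_diff_distrib)
  qed
  have T1: "T + r_fun CARD('p) CARD('d) \<tau> * (lam * (?n * ?d * v)) \<le> \<Lambda> * (?n * ?d *
       (q_fun CARD('d) \<tau> * (u * (2 - ?p * u / (?p - ?d)))
        + ?d * \<tau>\<^sup>2 * (w * (2 - ?p * ?d * w / (?p * ?d - 1)))))"
  proof -
    have "T = \<Lambda> * (\<Sum>\<Phi>\<in>Basis. G \<Phi> \<bullet> centered (G \<Phi>)) - (\<Sum>\<Phi>\<in>Basis. G \<Phi> \<bullet> L (G \<Phi>))"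
      by (simp add: T_def F_def inner_diff_right sum_subtractf sum_distrib_left)
    moreover have "(\<Sum>\<Phi>\<in>Basis. G \<Phi> \<bullet> centered (G \<Phi>)) =
       q_fun CARD('d) \<tau> * (?n * ?d - PP / ?n) + \<tau>\<^sup>2 * (?n * ?d\<^sup>2 - DD / ?n)"
      unfolding G_def sum_Basis_centered_directions[OF S] PP_def[symmetric] DD_def[symmetric]
      by (simp add: algebra_simps add_divide_distrib)
    moreover have "\<dots> \<le> q_fun CARD('d) \<tau> * (?n * ?d * (u * (2 - ?p * u / (?p - ?d))))
        + \<tau>\<^sup>2 * (?n * ?d\<^sup>2 * (w * (2 - ?p * ?d * w / (?p * ?d - 1))))"
      by (intro add_mono mult_left_mono PP DD q) simp
    moreover have "\<dots> = ?n * ?d * (q_fun CARD('d) \<tau> * (u * (2 - ?p * u / (?p - ?d)))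
        + ?d * \<tau>\<^sup>2 * (w * (2 - ?p * ?d * w / (?p * ?d - 1))))"
      unfolding power2_eq_square distrib_left by (simp only: mult_ac)
    ultimately have "T + (\<Sum>\<Phi>\<in>Basis. G \<Phi> \<bullet> L (G \<Phi>)) \<le> \<Lambda> * (?n * ?d * (q_fun CARD('d) \<tau> * (u * (2 - ?p * u / (?p - ?d)))
        + ?d * \<tau>\<^sup>2 * (w * (2 - ?p * ?d * w / (?p * ?d - 1)))))"
      using \<Lambda> by simp
    then show ?thesis using curvature by linarith
  qed
  have T2: "(\<Lambda> * \<sigma> * (?n * ?d * u))\<^sup>2 \<le> ?d * ((\<Lambda> - lam) * (?n * ?d * v)) * T"
  proof -
    \<comment> \<open>Pair \<open>L S = C S\<close> with constant families, which \<open>L\<close> annihilates.\<close>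
    have "(\<Sum>i\<in>UNIV. C i ** S $ i) = 0"
    proof -
      define Y where "Y = (\<Sum>i\<in>UNIV. C i ** S $ i)"
      have "0 = constant_family Y \<bullet> L S" using L(2)[of S "constant_family Y"] by (simp add: L(3))
      also have "\<dots> = Y \<bullet> Y"
        unfolding inner_vec_def[of "constant_family Y"]
        by (simp add: constant_family_def first inner_sum_right[symmetric] Y_def[symmetric])
      finally show ?thesis by (simp add: Y_def)
    qed
    then have KC: "(\<Sum>i\<in>UNIV. K \<bullet> (C i ** S $ i)) = 0" by (simp add: inner_sum_right[symmetric])
    have "G K \<bullet> L S = 0"
      unfolding inner_vec_def[of "G K"]
      by (simp add: first G_def direction_offset_inner_first_order(1)[OF S C H(1)] sum_negf KC)
    moreover have "G K \<bullet> centered S =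
       - (\<Sum>i\<in>UNIV. H \<bullet> mat 1 - (1 - \<tau>) * (H \<bullet> (N i ** transpose (N i))) - \<tau> * (H \<bullet> (N i ** N i)))"
    proof -
      have "(\<Sum>i\<in>UNIV. G K $ i \<bullet> S $ i) = - (\<Sum>i\<in>UNIV. K \<bullet> S $ i)"
        using direction_offset_inner_first_order(1)[OF S, of "mat 1" H] H(1) by (simp add: G_def sum_negf)
      also have "\<dots> = - (?n * (K \<bullet> (H ** K)))"
        by (simp add: inner_sum_right[symmetric] nX[symmetric] XHK)
      also have "K \<bullet> (H ** K) = H \<bullet> mat 1"
        using inner_mult_right_adjoint[of H K K] by (simp add: K inner_commute)
      finally have 1: "G K \<bullet> S = - (\<Sum>i\<in>(UNIV::'n set). H \<bullet> mat 1)" by (simp add: inner_vec_def[of "G K"])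
      have "G K \<bullet> constant_family X = (\<Sum>i\<in>UNIV. - (1 - \<tau>) * (H \<bullet> (N i ** transpose (N i))) - \<tau> * (H \<bullet> (N i ** N i)))"
        unfolding inner_vec_def[of "G K"] unfolding G_def constant_family_def XHK N_def
        by (simp add: direction_offset_inner_first_order(2)[OF S C H(1)])
      then show ?thesis
        unfolding centered_def X_def[symmetric] inner_diff_right 1
        by (simp only: sum_subtractf mult_minus_left sum_negf)
    qed
    ultimately have FS: "G K \<bullet> F S = - \<Lambda> *
       (\<Sum>i\<in>UNIV. H \<bullet> mat 1 - (1 - \<tau>) * (H \<bullet> (N i ** transpose (N i))) - \<tau> * (H \<bullet> (N i ** N i)))" (is "_ = - \<Lambda> * ?Z")
      by (simp add: F_def inner_diff_right)
    have "\<sigma> * (?n * ?d * u) = (\<Sum>i\<in>UNIV. \<sigma> * (?d - (norm (N i))\<^sup>2))"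
      using npos by (simp add: u_def a_def sum_distrib_left[symmetric] sum_subtractf field_simps)
    also have "\<dots> \<le> ?Z"
      unfolding N_def by (intro sum_mono polar_factor_trace_bound[OF S K H(1) \<sigma>(2) \<sigma>(1) \<tau>])
    finally have "\<Lambda> * (\<sigma> * (?n * ?d * u)) \<le> \<Lambda> * ?Z" using \<Lambda> by simp
    moreover have "0 \<le> \<Lambda> * (\<sigma> * (?n * ?d * u))" using \<Lambda> \<sigma>(1) uwv npos by simp
    ultimately have "(\<Lambda> * (\<sigma> * (?n * ?d * u)))\<^sup>2 \<le> (\<Lambda> * ?Z)\<^sup>2" by (rule power_mono)
    also have "(\<Lambda> * ?Z)\<^sup>2 = (G K \<bullet> F S)\<^sup>2" unfolding FS by simp
    also have "\<dots> \<le> (K \<bullet> K) * (S \<bullet> F S) * T"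
      unfolding T_def by (rule Cauchy_Schwarz_over_Basis[OF linF symF psdF linG])
    also have "K \<bullet> K = ?d" by (rule inner_stiefel_self[OF K])
    also have "?d * (S \<bullet> F S) * T \<le> ?d * ((\<Lambda> - lam) * (?n * ?d * v)) * T"
      using lowc[of S] \<open>0 \<le> T\<close> unfolding ScS
      by (intro mult_right_mono mult_left_mono) (auto simp: F_def inner_diff_right ScS algebra_simps)
    finally show ?thesis by (simp only: mult.assoc)
  qed
  have "?d * v = ?d - (norm X)\<^sup>2" using npos by (simp add: v_def right_diff_distrib)
  then have "1 - ?d * v \<le> \<sigma>\<^sup>2" using \<sigma>(3) by linarith
  from threshold_contradiction[OF \<alpha>(3) \<alpha>(1,2) lam \<Lambda> npos(1) _ pd uwv v(2,1) this T1 T2 \<open>0 \<le> T\<close>]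
  show False by simp
qed

section \<open>Alignment with the certified solution\<close>

text \<open>
  For orthogonal blocks \<open>Z\<^sub>i\<close> this is an isometry between families of blocks and matrices. It
  carries the families with equal blocks to the matrices \<open>Z M\<close>.
\<close>
definition rotate_blocks :: "real^'d^('n::finite \<times> 'd::finite) \<Rightarrow> real^'p^'d^'n \<Rightarrow> real^'p^('n \<times> 'd)" where
  "rotate_blocks Z U = (\<chi> r. (row_block Z (fst r) ** U $ fst r) $ snd r)"

definition unrotate_blocks :: "real^'d^('n::finite \<times> 'd::finite) \<Rightarrow> real^'p^('n \<times> 'd) \<Rightarrow> real^'p^'d^'n" where
  "unrotate_blocks Z Y = (\<chi> i. transpose (row_block Z i) ** row_block Y i)"

lemma row_block_rotate_blocks [simp]: "row_block (rotate_blocks Z U) i = row_block Z i ** U $ i"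
  by (simp add: row_block_def rotate_blocks_def vec_eq_iff)

lemma linear_rotate_blocks: "linear (rotate_blocks Z)"
  by (rule linearI) (simp_all add: row_block_eq_iff linear_add[OF linear_row_block]
    linear_cmul[OF linear_row_block] matrix_add_ldistrib linear_cmul[OF linear_mult_left])

lemma linear_unrotate_blocks: "linear (unrotate_blocks Z)"
  by (rule linearI) (simp_all add: unrotate_blocks_def vec_eq_iff linear_add[OF linear_row_block]
    linear_cmul[OF linear_row_block] matrix_add_ldistrib linear_cmul[OF linear_mult_left])

lemma inner_rotate_blocks: "rotate_blocks Z U \<bullet> Y = U \<bullet> unrotate_blocks Z Y"
  by (simp add: inner_row_blocks inner_vec_def[of U] unrotate_blocks_def inner_mult_left_adjoint)

lemma transpose_mult_row_blocks:
  fixes U :: "real^'p^('n::finite \<times> 'd::finite)"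
  shows "transpose U ** V = (\<Sum>i\<in>UNIV. transpose (row_block U i) ** row_block V i)"
  by (simp add: vec_eq_iff matrix_matrix_mult_def transpose_def row_block_def sum_component
      sum.cartesian_product case_prod_beta)

lemma inner_mult_columns:
  fixes Y :: "real^'p^'r" and M :: "real^'r^'r"
  shows "Y \<bullet> (M ** Y) = (\<Sum>k\<in>UNIV. transpose Y $ k \<bullet> (M *v (transpose Y $ k)))"
proof -
  have "Y \<bullet> (M ** Y) = transpose Y \<bullet> transpose (M ** Y)" by (simp add: inner_transpose_transpose)
  then show ?thesis
    by (simp add: inner_vec_def transpose_def matrix_matrix_mult_def matrix_vector_mult_def)
qed

lemma inner_self_columns:
  fixes Y :: "real^'p^'r"
  shows "Y \<bullet> Y = (\<Sum>k\<in>UNIV. (norm (transpose Y $ k))\<^sup>2)"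
  using inner_mult_columns[of Y "mat 1"] by (simp add: power2_norm_eq_inner)

text \<open>
  The columns of \<open>Z\<close> are linearly independent, so they span a \<open>d\<close>-dimensional subspace of the
  kernel of \<open>L\<close>, and the columns of \<open>Y\<close> are orthogonal to it.
\<close>
lemma nth_eigenvalue_le_centered:
  fixes Z :: "real^'d^('n::finite \<times> 'd::finite)" and L :: "real^('n \<times> 'd)^('n \<times> 'd)"
    and Y :: "real^'p^('n \<times> 'd)"
  assumes Z: "Z \<in> orthogonal_blocks" and L: "psd_matrix L" "L ** Z = 0"
    and pos: "nth_eigenvalue (CARD('d) + 1) L > 0" and ZY: "transpose Z ** Y = 0"
  shows "nth_eigenvalue (CARD('d) + 1) L * (Y \<bullet> Y) \<le> Y \<bullet> (L ** Y)"
proof -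
  let ?K = "range (\<lambda>y. Z *v y)"
  have ZZ: "transpose Z ** Z = real CARD('n) *\<^sub>R mat 1"
    using Z by (simp add: transpose_mult_row_blocks orthogonal_blocks_def orthogonal_matrix_def sum_constant_scaleR del: sum_constant)
  have "inj (\<lambda>y. Z *v y)"
  proof (rule injI)
    fix y z assume "Z *v y = Z *v z"
    then have "(transpose Z ** Z) *v y = (transpose Z ** Z) *v z" by (simp only: matrix_vector_mul_assoc[symmetric])
    then show "y = z" by (simp add: ZZ scaleR_matrix_vector_assoc[symmetric])
  qed
  then have dimK: "dim ?K = CARD('d)"
    using dim_image_eq[of "\<lambda>y. Z *v y" UNIV] by simp
  have sub: "subspace ?K" by (intro linear_subspace_image subspace_UNIV) simp
  have ker: "L *v x = 0" if "x \<in> ?K" for x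
    using that L(2) by (auto simp: matrix_vector_mul_assoc)
  have orth: "transpose Y $ k \<bullet> x = 0" if x: "x \<in> ?K" for x k
  proof -
    obtain y where "x = Z *v y" using x by auto
    then have "transpose Y $ k \<bullet> x = (\<Sum>j\<in>UNIV. (transpose Z ** Y) $ j $ k * y $ j)"
      by (simp add: inner_vec_def transpose_def matrix_matrix_mult_def matrix_vector_mult_def
          sum_distrib_left sum_distrib_right) (subst sum.swap, simp add: mult_ac)
    then show ?thesis by (simp add: ZY)
  qed
  show ?thesis
    unfolding inner_self_columns inner_mult_columns sum_distrib_left dimK[symmetric]
  proof (rule sum_mono)
    fix k
    show "nth_eigenvalue (dim ?K + 1) L * (norm (transpose Y $ k))\<^sup>2 \<le> transpose Y $ k \<bullet> (L *v (transpose Y $ k))"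
      by (rule nth_eigenvalue_le_Rayleigh[OF L(1) sub ker]) (use pos orth dimK in \<open>auto simp: Suc_leI\<close>)
  qed
qed

lemma inner_mult_le_max_eigenvalue:
  fixes Y :: "real^'p^'r"
  assumes "symmetric_matrix L"
  shows "Y \<bullet> (L ** Y) \<le> max_eigenvalue L * (Y \<bullet> Y)"
  unfolding inner_self_columns inner_mult_columns sum_distrib_left
  by (intro sum_mono Rayleigh_le_max_eigenvalue assms)

lemma stiefel_blocks_row_block:
  "S \<in> stiefel_blocks \<Longrightarrow> row_block S i ** transpose (row_block S i) = mat 1"
  by (simp add: stiefel_blocks_def stiefel_def)

text \<open>
  With \<open>C\<close> the difference of the multipliers at \<open>Z\<close> and at \<open>S\<close>, the quadratic form of the
  Hessian at \<open>S\<close> is twice that of \<open>L - C\<close>, since \<open>L - C\<close> is the multiplier at \<open>S\<close> minus \<open>A\<close>.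
\<close>
lemma second_order_critical_aligned:
  fixes A L :: "real^('n::finite \<times> 'd::finite)^('n \<times> 'd)"
    and Z :: "real^'d^('n \<times> 'd)" and S :: "real^'p^('n \<times> 'd)"
  assumes pd: "CARD('d) < CARD('p)" and A: "symmetric_matrix A" and Z: "Z \<in> orthogonal_blocks"
    and L: "L = BDG (A ** Z ** transpose Z) - A" "L ** Z = 0" "psd_matrix L"
    and pos: "nth_eigenvalue (CARD('d) + 1) L > 0"
    and ratio: "ereal (max_eigenvalue L / nth_eigenvalue (CARD('d) + 1) L) < alpha_G CARD('p) CARD('d)"
    and crit: "second_order_critical stiefel_blocks (objective A) S"
  obtains M where "M ** transpose M = mat 1" "S = Z ** M"
proof -
  have S: "S \<in> stiefel_blocks" and first: "A ** S = BDG (A ** S ** transpose S) ** S"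
    and second: "\<And>V. V \<in> stiefel_tangent S \<Longrightarrow> V \<bullet> (A ** V) \<le> V \<bullet> (BDG (A ** S ** transpose S) ** V)"
    using second_order_critical_stiefel[OF A crit] by auto
  let ?Z = "row_block Z" and ?S = "row_block S"
  have ZZ: "?Z i ** transpose (?Z i) = mat 1" "transpose (?Z i) ** ?Z i = mat 1" for i
    using Z by (auto simp: orthogonal_blocks_def orthogonal_matrix_def)
  have symL: "symmetric_matrix L" using L(3) by (simp add: psd_matrix_def)
  define CZ where "CZ i = sym_part (row_block (A ** Z) i ** transpose (?Z i))" for i
  define CS where "CS i = sym_part (row_block (A ** S) i ** transpose (?S i))" for i
  define C where "C i = transpose (?Z i) ** (CZ i - CS i) ** ?Z i" for i
  have BZ: "BDG (A ** Z ** transpose Z) = block_diagonal CZ" by (simp add: BDG_mult_transpose CZ_def[abs_def])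
  have BS: "BDG (A ** S ** transpose S) = block_diagonal CS" by (simp add: BDG_mult_transpose CS_def[abs_def])
  define Lop :: "real^'p^'d^'n \<Rightarrow> real^'p^'d^'n" where "Lop U = unrotate_blocks Z (L ** rotate_blocks Z U)" for U
  define W where "W = unrotate_blocks Z S"
  have rW: "rotate_blocks Z W = S"
    by (simp add: row_block_eq_iff W_def unrotate_blocks_def matrix_mul_assoc ZZ)
  have LopU: "U \<bullet> Lop V = rotate_blocks Z U \<bullet> (L ** rotate_blocks Z V)" for U V
    by (simp add: Lop_def inner_rotate_blocks)
  have rr: "rotate_blocks Z U \<bullet> rotate_blocks Z U = U \<bullet> U" for U :: "real^'p^'d^'n"
    by (simp add: inner_row_blocks inner_mult_left_adjoint matrix_mul_assoc ZZ inner_vec_def[of U])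
  have "W = constant_family (block_mean W)"
  proof (rule critical_family_constant[where L = Lop and C = C and
        lam = "nth_eigenvalue (CARD('d) + 1) L" and \<Lambda> = "max_eigenvalue L"])
    show "CARD('d) < CARD('p)" by (rule pd)
    show "W $ i ** transpose (W $ i) = mat 1" for i
    proof -
      have "W $ i ** transpose (W $ i) = transpose (?Z i) ** (?S i ** transpose (?S i)) ** ?Z i"
        by (simp add: W_def unrotate_blocks_def matrix_transpose_mul matrix_mul_assoc)
      then show ?thesis by (simp add: stiefel_blocks_row_block[OF S] ZZ)
    qed
    show "linear Lop"
      using linear_compose[OF linear_compose[OF linear_rotate_blocks linear_mult_left[of L]] linear_unrotate_blocks]
      by (simp add: Lop_def[abs_def] o_def)
    show "U \<bullet> Lop V = V \<bullet> Lop U" for U V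
      using symL inner_mult_left_adjoint[of L "rotate_blocks Z U" "rotate_blocks Z V"]
      by (simp add: LopU symmetric_matrix_def inner_commute)
    show "Lop (constant_family \<Phi>) = 0" for \<Phi>
    proof -
      have "rotate_blocks Z (constant_family \<Phi>) = Z ** \<Phi>"
        by (simp add: row_block_eq_iff row_block_mult constant_family_def)
      then show ?thesis
        using linear_0[OF linear_unrotate_blocks] linear_0[OF linear_mult_right]
        by (simp add: Lop_def matrix_mul_assoc L(2))
    qed
    show "nth_eigenvalue (CARD('d) + 1) L * (U \<bullet> U) \<le> U \<bullet> Lop U" if "block_mean U = 0" for U
    proof -
      have "transpose Z ** rotate_blocks Z U = (\<Sum>i\<in>UNIV. U $ i)"
        by (simp add: transpose_mult_row_blocks matrix_mul_assoc ZZ)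
      also have "\<dots> = 0" using that by (simp add: sum_block_mean)
      finally show ?thesis using nth_eigenvalue_le_centered[OF Z L(3,2) pos] by (metis LopU rr)
    qed
    show "U \<bullet> Lop U \<le> max_eigenvalue L * (U \<bullet> U)" for U
      using inner_mult_le_max_eigenvalue[OF symL, of "rotate_blocks Z U"] by (simp add: LopU rr)
    show "transpose (C i) = C i" for i
      by (simp add: C_def CZ_def CS_def matrix_transpose_mul linear_diff[OF linear_transpose]
          transpose_sym_part matrix_mul_assoc)
    show "Lop W $ i = C i ** W $ i" for i
    proof -
      have "row_block (L ** S) i = (CZ i - CS i) ** ?S i"
        by (simp add: L(1) linear_diff[OF linear_mult_right] BZ first[unfolded BS]
            linear_diff[OF linear_row_block] row_block_block_diagonal_mult)
      moreover have "C i ** W $ i = transpose (?Z i) ** (CZ i - CS i) ** (?Z i ** transpose (?Z i)) ** ?S i"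
        by (simp add: C_def W_def unrotate_blocks_def matrix_mul_assoc)
      ultimately show ?thesis
        by (simp add: Lop_def rW unrotate_blocks_def ZZ matrix_mul_assoc)
    qed
    show "(\<Sum>i\<in>UNIV. V $ i \<bullet> (C i ** V $ i)) \<le> V \<bullet> Lop V"
      if V: "\<And>i. V $ i ** transpose (W $ i) + W $ i ** transpose (V $ i) = 0" for V
    proof -
      let ?V = "rotate_blocks Z V"
      have "?V \<in> stiefel_tangent S"
        unfolding stiefel_tangent_def mem_Collect_eq
      proof
        fix i
        have Si: "?S i = ?Z i ** W $ i" using rW by (metis row_block_rotate_blocks)
        have "row_block ?V i ** transpose (?S i) + ?S i ** transpose (row_block ?V i) =
          ?Z i ** (V $ i ** transpose (W $ i) + W $ i ** transpose (V $ i)) ** transpose (?Z i)"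
          by (simp add: Si matrix_transpose_mul matrix_add_ldistrib matrix_mult_add_left matrix_mul_assoc)
        then show "row_block ?V i ** transpose (?S i) + ?S i ** transpose (row_block ?V i) = 0"
          using linear_0[OF linear_mult_left] linear_0[OF linear_mult_right] by (simp add: V)
      qed
      from second[OF this] have "?V \<bullet> (block_diagonal CZ ** ?V) - ?V \<bullet> (block_diagonal CS ** ?V) \<le> V \<bullet> Lop V"
        by (simp add: LopU L(1) linear_diff[OF linear_mult_right] BZ BS inner_diff_right)
      moreover have "(?Z i ** V $ i) \<bullet> (CZ i ** (?Z i ** V $ i)) - (?Z i ** V $ i) \<bullet> (CS i ** (?Z i ** V $ i))
          = V $ i \<bullet> (C i ** V $ i)" for i
      proof -
        have "(?Z i ** V $ i) \<bullet> (CZ i ** (?Z i ** V $ i)) - (?Z i ** V $ i) \<bullet> (CS i ** (?Z i ** V $ i)) =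
          (?Z i ** V $ i) \<bullet> ((CZ i - CS i) ** (?Z i ** V $ i))"
          by (simp add: linear_diff[OF linear_mult_right] inner_diff_right)
        then show ?thesis by (simp only: inner_mult_left_adjoint C_def matrix_mul_assoc)
      qed
      ultimately show ?thesis
        by (simp add: inner_row_blocks row_block_block_diagonal_mult sum_subtractf[symmetric])
    qed
  qed (use pos ratio in auto)
  then obtain M where M: "W = constant_family M" by blast
  have SM: "S = Z ** M"
    by (simp add: rW[symmetric] M row_block_eq_iff row_block_mult constant_family_def)
  have "M ** transpose M = mat 1"
  proof -
    fix i :: 'n
    have "mat 1 = ?S i ** transpose (?S i)" by (simp add: stiefel_blocks_row_block[OF S])
    then have "mat 1 = ?Z i ** (M ** transpose M) ** transpose (?Z i)"
      by (simp add: SM row_block_mult matrix_transpose_mul matrix_mul_assoc)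
    then have "transpose (?Z i) ** mat 1 ** ?Z i = (transpose (?Z i) ** ?Z i) ** (M ** transpose M) ** (transpose (?Z i) ** ?Z i)"
      by (simp only: matrix_mul_assoc)
    then show ?thesis by (simp add: ZZ)
  qed
  with SM that show ?thesis by blast
qed

text \<open>
  On the manifold the multiplier at \<open>Z\<close> contributes a constant, so up to that constant the
  objective is the quadratic form of \<open>L\<close>. It is minimal wherever \<open>L S = 0\<close>.
\<close>
lemma objective_eq_certificate:
  fixes Z :: "real^'d^('n::finite \<times> 'd::finite)" and S :: "real^'p^('n \<times> 'd)"
  assumes "L = BDG (A ** Z ** transpose Z) - A" and S: "S \<in> stiefel_blocks"
  shows "objective A S = S \<bullet> (L ** S) - (\<Sum>i\<in>UNIV. trace (sym_part (row_block (A ** Z) i ** transpose (row_block Z i))))"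
proof -
  have "row_block S i \<bullet> (C ** row_block S i) = trace C" for i and C :: "real^'d^'d"
    using inner_mult_right_adjoint[of C "row_block S i" "row_block S i"]
    by (simp add: stiefel_blocks_row_block[OF S] trace_eq_inner_mat inner_commute)
  then show ?thesis
    by (simp add: objective_eq_inner assms(1) linear_diff[OF linear_mult_right] inner_diff_right
        BDG_mult_transpose inner_row_blocks[of S "block_diagonal _ ** S"] row_block_block_diagonal_mult)
qed

theorem theorem2p1:
  fixes A L :: "real^('n::finite \<times> 'd::finite)^('n \<times> 'd)"
    and Z :: "real^'d^('n \<times> 'd)"
  assumes "CARD('n) \<ge> 2" and "CARD('d) \<ge> 1" and "CARD('p::finite) \<ge> CARD('d) + 1"
    and "symmetric_matrix A"
    and "Z \<in> orthogonal_blocks"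
    and "L = BDG (A ** Z ** transpose Z) - A"
    and "L ** Z = 0"
    and "psd_matrix L"
    and "nth_eigenvalue (CARD('d) + 1) L > 0"
    and "ereal (max_eigenvalue L / nth_eigenvalue (CARD('d) + 1) L) < alpha_G CARD('p) CARD('d)"
  shows "\<forall>S :: real^'p^('n \<times> 'd).
           second_order_critical stiefel_blocks (objective A) S \<longrightarrow>
             is_arg_min (objective A) (\<lambda>S'. S' \<in> stiefel_blocks) S \<and>
             S ** transpose S = Z ** transpose Z"
proof (intro allI impI)
  fix S :: "real^'p^('n \<times> 'd)"
  assume crit: "second_order_critical stiefel_blocks (objective A) S"
  have pd: "CARD('d) < CARD('p)" using assms(3) by simp
  obtain M where M: "M ** transpose M = mat 1" "S = Z ** M"
    using second_order_critical_aligned[OF pd assms(4-10) crit] by blast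
  have S: "S \<in> stiefel_blocks" using crit by (simp add: second_order_critical_def)
  have "S ** transpose S = Z ** (M ** transpose M) ** transpose Z"
    by (simp add: M(2) matrix_transpose_mul matrix_mul_assoc)
  then have "S ** transpose S = Z ** transpose Z" by (simp add: M(1))
  moreover have "objective A S \<le> objective A S'" if S': "S' \<in> stiefel_blocks" for S' :: "real^'p^('n \<times> 'd)"
  proof -
    have "L ** S = 0"
      using linear_0[OF linear_mult_right[of M]] by (simp add: M(2) matrix_mul_assoc assms(7))
    then have "S \<bullet> (L ** S) = 0" by simp
    also have "0 \<le> S' \<bullet> (L ** S')"
      using assms(8) by (simp add: inner_mult_columns psd_matrix_def sum_nonneg)
    finally show ?thesis
      using objective_eq_certificate[OF assms(6) S] objective_eq_certificate[OF assms(6) S'] by simp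
  qed
  ultimately show "is_arg_min (objective A) (\<lambda>S'. S' \<in> stiefel_blocks) S \<and> S ** transpose S = Z ** transpose Z"
    using S by (auto simp: is_arg_min_def not_less)
qed

end
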